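(* Let $\nu$ be a finite signed Borel measure on $\mathbb{R}_+=[0,\infty)$ and let $f\in L^1_{loc}(\mathbb{R}_+)$ be real-valued. For $\xi\in\mathbb{R}$ let $x(\cdot,\xi)$ denote the solution on $\mathbb{R}_+$ of $$x'(t)=\int_{[0,t]}\nu(ds)\,x(t-s)+f(t),\quad t\ge 0;\qquad x(0)=\xi .$$ Let $r$ be the differential resolvent of $\nu$, i.e. the unique absolutely continuous function on $\mathbb{R}_+$ satisfying $$r'(t)=\int_{[0,t]}\nu(ds)\,r(t-s),\quad t>0;\qquad r(0)=1,$$ and suppose $r\in L^1(\mathbb{R}_+)$. Then for every real $p\ge 1$ the following are equivalent: (A) for each $\theta\in(0,1]$, the function $t\mapsto\int_t^{t+\theta}f(s)\,ds$ belongs to $L^p(\mathbb{R}_+)$, i.e. $\left\Vert\int_{\cdot}^{\cdot+\theta}f(s)\,ds\right\Vert_{L^p(\mathbb{R}_+)}<+\infty$; (B) $x(\cdot,\xi)\in L^p(\mathbb{R}_+)$ for all $\xi\in\mathbb{R}$.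
   Context: A solution of the integrodifferential equation is a locally absolutely continuous function $x$ on $\mathbb{R}_+$ that satisfies the initial condition $x(0)=\xi$ and satisfies the equation for almost all $t>0$. Since $f\in L^1_{loc}(\mathbb{R}_+)$, such a solution exists, and it is given by the variation of constants formula $x(t,\xi)=r(t)\xi+\int_0^t r(t-s)f(s)\,ds$ for $t\ge0$. Likewise, the equation for $r$ is understood to hold for almost all $t>0$ and "absolutely continuous on $\mathbb{R}_+$" means locally absolutely continuous. All functions are scalar (real-valued). *)

theory Defs
  imports "HOL-Analysis.Analysis"
begin

text \<open>
  Finite signed measures on the measurable space underlying \<open>M\<close>, as real-valued set functions.
  Values outside \<open>sets M\<close> are irrelevant; \<open>\<nu> {} = 0\<close> follows by taking all \<open>A i\<close> empty.
\<close>

definition finite_signed_measure :: "'a measure \<Rightarrow> ('a set \<Rightarrow> real) \<Rightarrow> bool" where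
  "finite_signed_measure M \<nu> \<longleftrightarrow>
     (\<forall>A :: nat \<Rightarrow> 'a set. range A \<subseteq> sets M \<longrightarrow> disjoint_family A \<longrightarrow>
        (\<lambda>i. \<nu> (A i)) sums \<nu> (\<Union>i. A i))"

text \<open>
  The positive variation \<open>\<nu>\<^sup>+ A = sup {\<nu> B | B \<subseteq> A}\<close>. Since \<^const>\<open>ennreal\<close> truncates negative
  numbers to \<open>0\<close> and \<open>B = {}\<close> is admitted, the truncation does not change the supremum.
\<close>

definition positive_variation :: "'a measure \<Rightarrow> ('a set \<Rightarrow> real) \<Rightarrow> 'a measure" where
  "positive_variation M \<nu> =
     measure_of (space M) (sets M) (\<lambda>A. SUP B\<in>{B \<in> sets M. B \<subseteq> A}. ennreal (\<nu> B))"

definition negative_variation :: "'a measure \<Rightarrow> ('a set \<Rightarrow> real) \<Rightarrow> 'a measure" where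
  "negative_variation M \<nu> = positive_variation M (\<lambda>A. - \<nu> A)"

definition signed_set_integral ::
    "'a measure \<Rightarrow> ('a set \<Rightarrow> real) \<Rightarrow> 'a set \<Rightarrow> ('a \<Rightarrow> real) \<Rightarrow> real" where
  "signed_set_integral M \<nu> A g =
     set_lebesgue_integral (positive_variation M \<nu>) A g
     - set_lebesgue_integral (negative_variation M \<nu>) A g"

abbreviation borel_halfline :: "real measure" where
  "borel_halfline \<equiv> restrict_space borel {0..}"

text \<open>
  Functions on the half-line are represented by functions on \<^typ>\<open>real\<close>; only their values on
  \<open>{0..}\<close> matter in the notions below.
\<close>

definition Lp_halfline :: "real \<Rightarrow> (real \<Rightarrow> real) \<Rightarrow> bool" where
  "Lp_halfline p g \<longleftrightarrow>
     set_borel_measurable lebesgue {0..} g \<and>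
     set_integrable lebesgue {0..} (\<lambda>t. \<bar>g t\<bar> powr p)"

definition L1_loc_halfline :: "(real \<Rightarrow> real) \<Rightarrow> bool" where
  "L1_loc_halfline g \<longleftrightarrow> (\<forall>T\<ge>0. set_integrable lebesgue {0..T} g)"

text \<open>
  The usual \<open>\<epsilon>\<close>-\<open>\<delta>\<close> definition over finite families of non-overlapping compact intervals
  \<open>K = {Inf K..Sup K}\<close> contained in \<open>S\<close>.
\<close>

definition abs_continuous_on :: "real set \<Rightarrow> (real \<Rightarrow> real) \<Rightarrow> bool" where
  "abs_continuous_on S g \<longleftrightarrow>
     (\<forall>\<epsilon>>0. \<exists>\<delta>>0. \<forall>D. D division_of \<Union>D \<longrightarrow> \<Union>D \<subseteq> S \<longrightarrow>
        (\<Sum>K\<in>D. Sup K - Inf K) < \<delta> \<longrightarrow> (\<Sum>K\<in>D. \<bar>g (Sup K) - g (Inf K)\<bar>) < \<epsilon>)"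

definition locally_abs_continuous_halfline :: "(real \<Rightarrow> real) \<Rightarrow> bool" where
  "locally_abs_continuous_halfline g \<longleftrightarrow> (\<forall>T\<ge>0. abs_continuous_on {0..T} g)"

definition is_solution ::
    "(real set \<Rightarrow> real) \<Rightarrow> (real \<Rightarrow> real) \<Rightarrow> real \<Rightarrow> (real \<Rightarrow> real) \<Rightarrow> bool" where
  "is_solution \<nu> f \<xi> x \<longleftrightarrow>
     locally_abs_continuous_halfline x \<and> x 0 = \<xi> \<and>
     (AE t in lebesgue. t > 0 \<longrightarrow>
        (x has_real_derivative
           signed_set_integral borel_halfline \<nu> {0..t} (\<lambda>s. x (t - s)) + f t) (at t))"

definition is_differential_resolvent :: "(real set \<Rightarrow> real) \<Rightarrow> (real \<Rightarrow> real) \<Rightarrow> bool" where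
  "is_differential_resolvent \<nu> r \<longleftrightarrow>
     locally_abs_continuous_halfline r \<and> r 0 = 1 \<and>
     (AE t in lebesgue. t > 0 \<longrightarrow>
        (r has_real_derivative
           signed_set_integral borel_halfline \<nu> {0..t} (\<lambda>s. r (t - s))) (at t))"

end

theory Submission
  imports Defs
begin

text \<open>
  Write \<open>*\<close> for convolution of functions that vanish on negative times and \<open>F t\<close> for the integral of
  \<open>f\<close> over \<open>[0, t]\<close>. From (B) to (A): \<open>F = x - 1 * (\<nu> * x)\<close> for \<open>\<xi> = 0\<close>, and \<open>\<nu> * x\<close> is in \<open>L\<^sup>p\<close>
  by Young's inequality. From (A) to (B): by variation of constants \<open>x = \<xi> r + r * f\<close>. The function
  \<open>f1 t = F t - F (t - 1)\<close> is in \<open>L\<^sup>p\<close>, and so is the primitive \<open>F2\<close> of \<open>f - f1\<close>, being the average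
  over \<open>v \<in> [0, 1]\<close> of \<open>t \<mapsto> F t - F (t - v)\<close>, whose norms are bounded uniformly in \<open>v\<close> by a Baire
  category argument. Integrating by parts, \<open>r * f = r * f1 + F2 + r' * F2\<close>, where \<open>r\<close> and
  \<open>r' = \<nu> * r\<close> are in \<open>L\<^sup>1\<close>.
\<close>

section \<open>Absolutely continuous functions\<close>

text \<open>The obstacle in deriving (B) is that f is only locally integrable, so Young's inequality
  does not apply to r * f. The remedy is the splitting f = f1 + (f - f1), where f1 is the
  convolution of f with the indicator of [0, 1]: the first summand is itself a window integral, and
  the second may be rough but has a primitive in L^p. Condition (A) is given for each \<theta>
  separately, with no control of the norm in \<theta>, whereas averaging over shifts calls for a
  common bound; hence the Baire argument, which rests on the continuity of F and on translation
  invariance. Derivatives occur only once, when the equation is turned into an integral equation;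
  from then on a primitive is a convolution with the indicator of the half-line, and the identities
  reduce to linearity and to interchanging two convolutions. Functions are extended by zero to the
  whole line, so that translations preserve Lebesgue measure. Integrals of p-th powers replace
  norms: only finiteness matters, so crude constants such as 2^p suffice.\<close>

lemma tagged_partial_division_inj_snd:
  fixes p :: "(real \<times> real set) set"
  assumes p: "p tagged_partial_division_of S"
  shows "inj_on snd p"
proof (rule inj_onI, clarsimp)
  fix x y K
  assume xK: "(x, K) \<in> p" and yK: "(y, K) \<in> p"
  note P = tagged_partial_division_ofD[OF p]
  obtain u v where K: "K = {u..v}"
    using P(4)[OF xK] by auto
  show "x = y"
  \<comment> \<open>Pairs with different tags have sets with disjoint interiors, so u < v forces
    equal tags; otherwise K is a single point, which is its tag.\<close>
  proof (cases "u < v")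
    case True
    then have "interior K \<noteq> {}" by (simp add: K)
    then show ?thesis using P(5)[OF xK yK] by auto
  next
    case False
    then show ?thesis using P(2)[OF xK] P(2)[OF yK] by (auto simp: K)
  qed
qed

lemma open_cover_negligible:
  fixes N :: "'a::euclidean_space set"
  assumes N: "negligible N" and "\<delta> > 0"
  obtains U where "open U" "N \<subseteq> U" "emeasure lebesgue U < ennreal \<delta>"
proof -
  have N': "N \<in> null_sets lebesgue" using N negligible_iff_null_sets by blast
  obtain U where U: "open U" "N \<subseteq> U" "emeasure lebesgue (U - N) < ennreal \<delta>"
    using sets_lebesgue_outer_open[of N \<delta>] N' \<open>\<delta> > 0\<close> by (metis null_setsD2)
  have "U \<in> sets lebesgue" using U(1) by auto
  then have "emeasure lebesgue (U - N) = emeasure lebesgue U"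
    using N' by (rule emeasure_Diff_null_set[rotated])
  then show ?thesis using U that by auto
qed

text \<open>Tags in the exceptional null set are confined by the gauge to an open set of small measure,
  where absolute continuity controls the increments; elsewhere the straddle estimate applies.\<close>

lemma has_integral_derivative_abs_continuous:
  fixes g g' :: "real \<Rightarrow> real"
  assumes ab: "a \<le> b" and ac: "abs_continuous_on {a..b} g" and N: "negligible N"
    and deriv: "\<And>t. t \<in> {a..b} - N \<Longrightarrow> (g has_real_derivative g' t) (at t within {a..b})"
  shows "(g' has_integral (g b - g a)) {a..b}"
proof (cases "a = b")
  case True
  then show ?thesis by (simp add: has_integral_refl)
next
  case False
  with ab have ab': "a < b" by simp
  \<comment> \<open>Changing the derivative on N does not affect the integral. With value 0 there, a
    tag in N contributes exactly an increment of g, which absolute continuity controls.\<close>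
  define h where "h t = (if t \<in> N then 0 else g' t)" for t
  have "(h has_integral (g b - g a)) (cbox a b)"
    unfolding has_integral_factor_content
  proof (intro allI impI)
    fix e :: real assume e: "e > 0"
    define e2 where "e2 = e / 2"
    have e2: "e2 > 0" using e by (simp add: e2_def)
    have "e2 * (b - a) > 0" using e2 ab' by simp
    with ac obtain \<delta> where \<delta>: "\<delta> > 0" and AC: "\<And>D. D division_of \<Union>D \<Longrightarrow> \<Union>D \<subseteq> {a..b} \<Longrightarrow>
        (\<Sum>K\<in>D. Sup K - Inf K) < \<delta> \<Longrightarrow> (\<Sum>K\<in>D. \<bar>g (Sup K) - g (Inf K)\<bar>) < e2 * (b - a)"
      unfolding abs_continuous_on_def by (elim allE[of _ "e2 * (b - a)"]) auto
    obtain U where U: "open U" "N \<subseteq> U" "emeasure lebesgue U < ennreal \<delta>"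
      by (rule open_cover_negligible[OF N \<delta>])
    have "\<exists>d>0. (x \<in> {a..b} - N \<longrightarrow> (\<forall>y\<in>{a..b}. \<bar>y - x\<bar> < d \<longrightarrow>
               \<bar>g y - g x - (y - x) * h x\<bar> \<le> e2 * \<bar>y - x\<bar>)) \<and> (x \<in> N \<longrightarrow> ball x d \<subseteq> U)" for x
    proof (cases "x \<in> N")
      case True
      then have "x \<in> U" using U(2) by blast
      then obtain d where "d > 0" "ball x d \<subseteq> U" using U(1) openE by blast
      then show ?thesis using True by blast
    next
      case xN: False
      show ?thesis
      proof (cases "x \<in> {a..b}")
        case True
        then have "(g has_derivative (\<lambda>y. g' x * y)) (at x within {a..b})"
          using deriv[of x] xN unfolding has_field_derivative_def by auto
        then obtain d where "d > 0" "\<forall>y\<in>{a..b}. norm (y - x) < d \<longrightarrow>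
             norm (g y - g x - g' x * (y - x)) \<le> e2 * norm (y - x)"
          unfolding has_derivative_within_alt using e2 by blast
        then show ?thesis using xN by (intro exI[of _ d]) (auto simp: h_def mult.commute)
      qed (use xN in \<open>auto intro: exI[of _ 1]\<close>)
    qed
    then obtain d where d0: "\<And>x. d x > 0"
      and dd: "\<And>x y. x \<in> {a..b} - N \<Longrightarrow> y \<in> {a..b} \<Longrightarrow> \<bar>y - x\<bar> < d x \<Longrightarrow>
               \<bar>g y - g x - (y - x) * h x\<bar> \<le> e2 * \<bar>y - x\<bar>"
      and dU: "\<And>x. x \<in> N \<Longrightarrow> ball x (d x) \<subseteq> U"
      by metis
    show "\<exists>d. gauge d \<and> (\<forall>p. p tagged_division_of cbox a b \<and> d fine p \<longrightarrow>
       norm ((\<Sum>(x, k)\<in>p. measure lborel k *\<^sub>R h x) - (g b - g a)) \<le> e * measure lborel (cbox a b))"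
    proof (rule exI[of _ "\<lambda>x. ball x (d x)"], safe)
      show "gauge (\<lambda>x. ball x (d x))" using d0 gauge_ball_dependent by blast
    next
      fix p assume p: "p tagged_division_of cbox a b" and fine: "(\<lambda>x. ball x (d x)) fine p"
      note P = tagged_division_ofD[OF p]
      define E where "E z = (case z of (x, K) \<Rightarrow> measure lborel K *\<^sub>R h x - (g (Sup K) - g (Inf K)))" for z
      define q where "q = {z \<in> p. fst z \<in> N}"
      have fin: "finite p" using P(1) .
      have ba: "b - a = (\<Sum>(x,K)\<in>p. Sup K - Inf K)" "g b - g a = (\<Sum>(x,K)\<in>p. g(Sup K) - g(Inf K))"
        using additive_tagged_division_1[where f= "\<lambda>x. x"] additive_tagged_division_1[where f= g] ab p
        by auto
      have ivl: "\<exists>u v. K = {u..v} \<and> u \<le> v \<and> x \<in> {u..v} \<and> {u..v} \<subseteq> {a..b}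
          \<and> Sup K = v \<and> Inf K = u \<and> measure lborel K = v - u" if z: "(x, K) \<in> p" for x K
      proof -
        obtain u v where K: "K = {u..v}" using P(4)[OF z] by auto
        have "x \<in> {u..v}" using P(2)[OF z] K by simp
        then show ?thesis using K P(3)[OF z] by (intro exI[of _ u] exI[of _ v]) auto
      qed
      have "q \<subseteq> p" by (auto simp: q_def)
      then have qtag: "q tagged_partial_division_of cbox a b"
        using p unfolding tagged_division_of_def by (auto intro: tagged_partial_division_subset)
      have "\<bar>\<Sum>z\<in>q. E z\<bar> \<le> (\<Sum>z\<in>q. \<bar>E z\<bar>)" by (rule sum_abs)
      also have "\<dots> = (\<Sum>z\<in>q. \<bar>g (Sup (snd z)) - g (Inf (snd z))\<bar>)"
        by (rule sum.cong) (auto simp: q_def E_def h_def)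
      also have "\<dots> = (\<Sum>K\<in>snd ` q. \<bar>g (Sup K) - g (Inf K)\<bar>)"
        using tagged_partial_division_inj_snd[OF qtag] by (simp add: sum.reindex)
      also have "\<dots> \<le> e2 * (b - a)"
      proof (rule less_imp_le, rule AC)
        show D: "snd ` q division_of \<Union> (snd ` q)"
          using partial_division_of_tagged_division[OF qtag] .
        show "\<Union> (snd ` q) \<subseteq> {a..b}"
        proof (clarsimp simp: q_def subset_iff)
          fix x K y assume "(x, K) \<in> p" "y \<in> K"
          then show "a \<le> y \<and> y \<le> b" using P(3)[of x K] by auto
        qed
        \<comment> \<open>The intervals do not overlap, so their total length is the measure of
          their union, which the gauge keeps inside U.\<close>
        have "(\<Sum>K\<in>snd ` q. Sup K - Inf K) = (\<Sum>K\<in>snd ` q. measure lebesgue K)"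
        proof (rule sum.cong, safe)
          fix x K assume "(x, K) \<in> q"
          then have "(x, K) \<in> p" by (simp add: q_def)
          then obtain u v where "K = {u..v}" "u \<le> v" using ivl by blast
          then show "Sup (snd (x, K)) - Inf (snd (x, K)) = measure lebesgue (snd (x, K))"
            by simp
        qed
        also have "\<dots> = measure lebesgue (\<Union> (snd ` q))"
          using content_division[OF D] by simp
        also have "\<dots> < \<delta>"
        proof -
          have "K \<subseteq> U" if "(x, K) \<in> p" "x \<in> N" for x K
            using fineD[OF fine that(1)] dU[OF that(2)] by simp
          then have "\<Union> (snd ` q) \<subseteq> U" unfolding q_def by fastforce
          then have "emeasure lebesgue (\<Union> (snd ` q)) \<le> emeasure lebesgue U"
            using U(1) by (intro emeasure_mono) auto
          then have "emeasure lebesgue (\<Union> (snd ` q)) < ennreal \<delta>" using U(3) by simp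
          moreover from this have "emeasure lebesgue (\<Union> (snd ` q)) \<noteq> top" by auto
          ultimately show ?thesis
            by (simp add: emeasure_eq_ennreal_measure ennreal_less_iff)
        qed
        finally show "(\<Sum>K\<in>snd ` q. Sup K - Inf K) < \<delta>" .
      qed
      finally have 1: "\<bar>\<Sum>z\<in>q. E z\<bar> \<le> e2 * (b - a)" .
      have "\<bar>\<Sum>z\<in>p - q. E z\<bar> \<le> (\<Sum>z\<in>p-q. \<bar>E z\<bar>)" by (rule sum_abs)
      also have "\<dots> \<le> (\<Sum>z\<in>p-q. e2 * (Sup (snd z) - Inf (snd z)))"
      proof (rule sum_mono, clarify)
        fix x K assume z: "(x, K) \<in> p" "(x, K) \<notin> q"
        obtain u v where K: "K = {u..v}" "u \<le> v" "x \<in> {u..v}" "{u..v} \<subseteq> {a..b}"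
          "Sup K = v" "Inf K = u" "measure lborel K = v - u" using ivl[OF z(1)] by blast
        have xN: "x \<in> {a..b} - N" using z K by (auto simp: q_def)
        have "K \<subseteq> ball x (d x)" using fine z(1) by (auto simp: fine_def)
        moreover have "u \<in> K" "v \<in> K" using K by auto
        ultimately have "u \<in> ball x (d x)" "v \<in> ball x (d x)" by blast+
        then have "\<bar>u - x\<bar> < d x" "\<bar>v - x\<bar> < d x" by (auto simp: dist_real_def)
        then have "\<bar>g u - g x - (u - x) * h x\<bar> \<le> e2 * \<bar>u - x\<bar>" "\<bar>g v - g x - (v - x) * h x\<bar> \<le> e2 * \<bar>v - x\<bar>"
          using dd[OF xN, of u] dd[OF xN, of v] K(2,4) by auto
        moreover have "e2 * \<bar>u - x\<bar> + e2 * \<bar>v - x\<bar> = e2 * (v - u)"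
        proof -
          have "\<bar>u - x\<bar> = x - u" "\<bar>v - x\<bar> = v - x" using K(3) by auto
          then show ?thesis by (simp only: distrib_left[symmetric]) simp
        qed
        moreover have "(v - u) * h x = (v - x) * h x - (u - x) * h x" by (simp add: algebra_simps)
        ultimately have "\<bar>(v - u) * h x - (g v - g u)\<bar> \<le> e2 * (v - u)" by linarith
        then show "\<bar>E (x, K)\<bar> \<le> e2 * (Sup (snd (x, K)) - Inf (snd (x, K)))"
          using K by (simp add: E_def)
      qed
      also have "\<dots> \<le> (\<Sum>z\<in>p. e2 * (Sup (snd z) - Inf (snd z)))"
      proof (rule sum_mono2[OF fin])
        fix z assume "z \<in> p - (p - q)"
        then obtain x K where z: "z = (x, K)" "(x, K) \<in> p" by (cases z) auto
        show "0 \<le> e2 * (Sup (snd z) - Inf (snd z))"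
          using ivl[OF z(2)] e2 z(1) by auto
      qed auto
      also have "\<dots> = e2 * (b - a)"
        unfolding ba(1) by (simp add: sum_distrib_left case_prod_unfold)
      finally have 2: "\<bar>\<Sum>z\<in>p - q. E z\<bar> \<le> e2 * (b - a)" .
      have "(\<Sum>(x, k)\<in>p. measure lborel k *\<^sub>R h x) - (g b - g a) = (\<Sum>z\<in>p. E z)"
        unfolding ba(2) by (simp add: E_def sum_subtractf case_prod_unfold)
      also have "\<dots> = (\<Sum>z\<in>q. E z) + (\<Sum>z\<in>p-q. E z)"
        using sum.subset_diff[OF \<open>q \<subseteq> p\<close> fin, of E] by simp
      finally show "norm ((\<Sum>(x, k)\<in>p. measure lborel k *\<^sub>R h x) - (g b - g a)) \<le> e * measure lborel (cbox a b)"
        using 1 2 ab by (simp add: e2_def)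
    qed
  qed
  then have "(h has_integral (g b - g a)) {a..b}" by simp
  then show ?thesis
    by (rule has_integral_spike[OF N, rotated]) (auto simp: h_def)
qed

lemma abs_continuous_on_imp_continuous_on:
  assumes ac: "abs_continuous_on {a..b} g"
  shows "continuous_on {a..b} (g :: real \<Rightarrow> real)"
  unfolding continuous_on_iff
proof (intro ballI allI impI)
  fix x e :: real assume x: "x \<in> {a..b}" and "e > 0"
  with ac obtain \<delta> where \<delta>: "\<delta> > 0" and AC: "\<And>D. D division_of \<Union>D \<Longrightarrow> \<Union>D \<subseteq> {a..b} \<Longrightarrow>
        (\<Sum>K\<in>D. Sup K - Inf K) < \<delta> \<Longrightarrow> (\<Sum>K\<in>D. \<bar>g (Sup K) - g (Inf K)\<bar>) < e"
    unfolding abs_continuous_on_def by (elim allE[of _ e]) auto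
  have *: "\<bar>g v - g u\<bar> < e" if "u \<in> {a..b}" "v \<in> {a..b}" "u \<le> v" "v - u < \<delta>" for u v
    using AC[of "{{u..v}}"] that by (auto simp: division_of_def)
  show "\<exists>d>0. \<forall>x'\<in>{a..b}. dist x' x < d \<longrightarrow> dist (g x') (g x) < e"
  proof (intro exI conjI ballI impI)
    fix y assume y: "y \<in> {a..b}" "dist y x < \<delta>"
    show "dist (g y) (g x) < e"
      using *[of x y] *[of y x] x y by (cases "x \<le> y") (auto simp: dist_real_def)
  qed (fact \<delta>)
qed

section \<open>Finite signed measures\<close>

lemma finite_signed_measure_empty:
  assumes "finite_signed_measure M \<nu>"
  shows "\<nu> {} = 0"
proof -
  have "(\<lambda>i::nat. \<nu> {}) sums \<nu> (\<Union>i::nat. {})"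
    using assms[unfolded finite_signed_measure_def, rule_format, of "\<lambda>_. {}"]
    by (auto simp: disjoint_family_on_def)
  then have "summable (\<lambda>i::nat. \<nu> {})" by (rule sums_summable)
  then show ?thesis by (simp add: summable_const_iff)
qed

lemma finite_signed_measure_Un:
  assumes \<nu>: "finite_signed_measure M \<nu>" and "A \<in> sets M" "B \<in> sets M" "A \<inter> B = {}"
  shows "\<nu> (A \<union> B) = \<nu> A + \<nu> B"
proof -
  define F where "F i = (if i = 0 then A else if i = 1 then B else {})" for i :: nat
  have "range F \<subseteq> sets M" "disjoint_family F"
    using assms by (auto simp: F_def disjoint_family_on_def)
  then have "(\<lambda>i. \<nu> (F i)) sums \<nu> (\<Union>i. F i)"
    using \<nu> by (simp add: finite_signed_measure_def)
  moreover have "(\<Union>i. F i) = A \<union> B"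
  proof -
    have "(\<Union>i. F i) \<subseteq> A \<union> B" by (auto simp: F_def split: if_splits)
    moreover have "A \<subseteq> (\<Union>i. F i)" by (rule order_trans[OF _ UN_upper[of 0]]) (auto simp: F_def)
    moreover have "B \<subseteq> (\<Union>i. F i)" by (rule order_trans[OF _ UN_upper[of 1]]) (auto simp: F_def)
    ultimately show ?thesis by blast
  qed
  moreover have "(\<lambda>i. \<nu> (F i)) sums (\<Sum>i\<in>{0,1}. \<nu> (F i))"
    by (rule sums_finite) (auto simp: F_def finite_signed_measure_empty[OF \<nu>])
  ultimately have "\<nu> (A \<union> B) = (\<Sum>i\<in>{0,1}. \<nu> (F i))" by (metis sums_unique2)
  then show ?thesis by (simp add: F_def)
qed

lemma finite_signed_measure_Diff:
  assumes \<nu>: "finite_signed_measure M \<nu>" and "A \<in> sets M" "B \<in> sets M" "B \<subseteq> A"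
  shows "\<nu> (A - B) = \<nu> A - \<nu> B"
proof -
  have "B \<union> (A - B) = A" using assms(4) by blast
  then show ?thesis
    using finite_signed_measure_Un[OF \<nu>, of B "A - B"] assms by auto
qed

lemma finite_signed_measure_uminus:
  "finite_signed_measure M \<nu> \<Longrightarrow> finite_signed_measure M (\<lambda>A. - \<nu> A)"
  by (auto simp: finite_signed_measure_def sums_minus)

text \<open>If \<open>\<nu>\<close> is unbounded on the subsets of \<open>E\<close>, then it is unbounded on the subsets of some
  \<open>F \<subseteq> E\<close> with \<open>\<bar>\<nu> (E - F)\<bar> \<ge> 1\<close>; iterating contradicts countable additivity.\<close>

lemma finite_signed_measure_bounded:
  assumes \<nu>: "finite_signed_measure M \<nu>"
  obtains C where "\<And>A. A \<in> sets M \<Longrightarrow> \<bar>\<nu> A\<bar> \<le> C"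
proof (rule ccontr)
  assume neg: "\<not> thesis"
  define unb where
    "unb E \<longleftrightarrow> E \<in> sets M \<and> (\<forall>C. \<exists>B\<in>sets M. B \<subseteq> E \<and> \<bar>\<nu> B\<bar> > C)" for E
  have step: "\<exists>F. unb F \<and> F \<subseteq> E \<and> \<bar>\<nu> (E - F)\<bar> \<ge> 1" if E: "unb E" for E
  proof -
    \<comment> \<open>The threshold makes both \<open>\<bar>\<nu> B\<bar>\<close> and
      \<open>\<bar>\<nu> (E - B)\<bar>\<close> at least 1, so whichever of B and E - B still has
      unbounded subsets can serve as F.\<close>
    obtain B where B: "B \<in> sets M" "B \<subseteq> E" "\<bar>\<nu> B\<bar> > \<bar>\<nu> E\<bar> + 1"
      using E unfolding unb_def by blast
    have Es: "E \<in> sets M" using E by (simp add: unb_def)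
    have d: "\<nu> (E - B) = \<nu> E - \<nu> B" using finite_signed_measure_Diff[OF \<nu> Es B(1,2)] .
    have dB: "E - (E - B) = B" using B(2) by blast
    show ?thesis
    proof (cases "unb B")
      case True
      then show ?thesis using B d by (intro exI[of _ B]) auto
    next
      case False
      then obtain C where C: "\<And>A. A \<in> sets M \<Longrightarrow> A \<subseteq> B \<Longrightarrow> \<bar>\<nu> A\<bar> \<le> C"
        using B(1) unfolding unb_def by (auto simp: not_less)
      \<comment> \<open>A subset G of E with large value keeps it after removing B, since the part
        inside B accounts for at most C.\<close>
      have "unb (E - B)"
        unfolding unb_def
      proof (intro conjI allI)
        fix D
        obtain G where G: "G \<in> sets M" "G \<subseteq> E" "\<bar>\<nu> G\<bar> > D + C"
          using E unfolding unb_def by blast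
        have "(G \<inter> B) \<union> (G - B) = G" by blast
        then have "\<nu> G = \<nu> (G \<inter> B) + \<nu> (G - B)"
          using finite_signed_measure_Un[OF \<nu>, of "G \<inter> B" "G - B"] G(1) B(1) by auto
        moreover have "\<bar>\<nu> (G \<inter> B)\<bar> \<le> C" using C[of "G \<inter> B"] G B by auto
        ultimately have "\<bar>\<nu> (G - B)\<bar> > D" using G(3) by linarith
        then show "\<exists>B'\<in>sets M. B' \<subseteq> E - B \<and> D < \<bar>\<nu> B'\<bar>"
          using G B by (intro bexI[of _ "G - B"]) auto
      qed (use Es B in auto)
      then show ?thesis using B dB by (intro exI[of _ "E - B"]) auto
    qed
  qed
  have top: "unb (space M)"
    unfolding unb_def
  proof (intro conjI allI)
    fix C
    have "\<not> (\<forall>A. A \<in> sets M \<longrightarrow> \<bar>\<nu> A\<bar> \<le> C)" using neg that by blast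
    then show "\<exists>B\<in>sets M. B \<subseteq> space M \<and> C < \<bar>\<nu> B\<bar>"
      using sets.sets_into_space by (fastforce simp: not_le)
  qed simp
  have "\<exists>F. \<forall>n. unb (F n) \<and> F (Suc n) \<subseteq> F n \<and> \<bar>\<nu> (F n - F (Suc n))\<bar> \<ge> 1"
    using dependent_nat_choice[of "\<lambda>_. unb" "\<lambda>_ E F. F \<subseteq> E \<and> \<bar>\<nu> (E - F)\<bar> \<ge> 1"] top step
    by blast
  then obtain F where F: "\<And>n::nat. unb (F n)" "\<And>n. F (Suc n) \<subseteq> F n"
     "\<And>n. \<bar>\<nu> (F n - F (Suc n))\<bar> \<ge> 1" by blast
  have dec: "F n \<subseteq> F m" if "m \<le> n" for m n
    using lift_Suc_antimono_le[of F, OF F(2) that] .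
  define A where "A n = F n - F (Suc n)" for n
  have "A m \<inter> A n = {}" if "m < n" for m n
    using dec[of "Suc m" n] that by (auto simp: A_def)
  then have "disjoint_family A"
    unfolding disjoint_family_on_def by (metis inf_commute nat_neq_iff)
  moreover have "range A \<subseteq> sets M" using F(1) by (auto simp: A_def unb_def)
  ultimately have "(\<lambda>i. \<nu> (A i)) sums \<nu> (\<Union>i. A i)"
    using \<nu> by (simp add: finite_signed_measure_def)
  then have "(\<lambda>i. \<nu> (A i)) \<longlonglongrightarrow> 0" by (intro summable_LIMSEQ_zero sums_summable)
  then have "eventually (\<lambda>i. \<bar>\<nu> (A i)\<bar> < 1) sequentially"
    using order_tendstoD(2)[OF tendsto_rabs_zero, of "\<lambda>i. \<nu> (A i)" sequentially 1] by simp
  then show False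
    using F(3) by (auto simp: A_def eventually_sequentially not_less[symmetric])
qed

section \<open>Finiteness of the variations\<close>

lemma sets_positive_variation [simp]: "sets (positive_variation M \<nu>) = sets M"
  by (simp add: positive_variation_def sets.sigma_sets_eq sets.space_closed)

lemma space_positive_variation [simp]: "space (positive_variation M \<nu>) = space M"
  by (simp add: positive_variation_def sets.space_closed)

text \<open>Countable additivity of the variation is not needed: if it failed, \<^const>\<open>measure_of\<close> would
  give the null measure, so boundedness of \<open>\<nu>\<close> suffices.\<close>

lemma finite_measure_positive_variation:
  assumes \<nu>: "finite_signed_measure M \<nu>"
  shows "finite_measure (positive_variation M \<nu>)"
proof
  obtain C where C: "\<And>A. A \<in> sets M \<Longrightarrow> \<bar>\<nu> A\<bar> \<le> C"
    by (rule finite_signed_measure_bounded[OF \<nu>]) blast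
  have "emeasure (positive_variation M \<nu>) (space M)
      \<le> (SUP B\<in>{B \<in> sets M. B \<subseteq> space M}. ennreal (\<nu> B))"
    unfolding positive_variation_def emeasure_measure_of_conv by auto
  also have "\<dots> \<le> ennreal C"
    using C by (intro SUP_least ennreal_leI) (auto simp: abs_le_iff)
  also have "\<dots> < \<infinity>" by simp
  finally show "emeasure (positive_variation M \<nu>) (space (positive_variation M \<nu>)) \<noteq> \<infinity>" by simp
qed

lemma finite_measure_negative_variation:
  "finite_signed_measure M \<nu> \<Longrightarrow> finite_measure (negative_variation M \<nu>)"
  unfolding negative_variation_def
  by (intro finite_measure_positive_variation finite_signed_measure_uminus)

lemma sets_space_negative_variation [simp]:
  "sets (negative_variation M \<nu>) = sets M" "space (negative_variation M \<nu>) = space M"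
  by (simp_all add: negative_variation_def)

text \<open>Transports a measure on the half-line to the Borel sets of the line, so that measures
  and densities can be convolved in one and the same setting.\<close>

definition borel_of_halfline :: "real measure \<Rightarrow> real measure" where
  "borel_of_halfline \<mu> = distr \<mu> borel (\<lambda>s. s)"

context
  fixes \<mu> :: "real measure"
  assumes sets_mu: "sets \<mu> = sets borel_halfline"
begin

lemma space_halfline_measure: "space \<mu> = {0..}"
  using sets_eq_imp_space_eq[OF sets_mu] by (simp add: space_restrict_space)

lemma measurable_id_halfline: "(\<lambda>s. s) \<in> measurable \<mu> borel"
  using measurable_restrict_space1[OF measurable_ident, of borel "{0..}"]
  by (simp add: measurable_cong_sets[OF sets_mu refl] id_def)

lemma sets_borel_of_halfline [simp]: "sets (borel_of_halfline \<mu>) = sets borel"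
  by (simp add: borel_of_halfline_def)

lemma finite_measure_borel_of_halfline:
  "finite_measure \<mu> \<Longrightarrow> finite_measure (borel_of_halfline \<mu>)"
  unfolding borel_of_halfline_def
  by (rule finite_measure.finite_measure_distr[OF _ measurable_id_halfline])

text \<open>The two indicators encode 0 \<le> s \<le> t: cutting g off at negative times turns the
  truncated integral of the equation into a convolution on the line.\<close>

lemma set_integral_halfline_measure:
  fixes g :: "real \<Rightarrow> real"
  assumes "(\<lambda>t. indicator {0..} t * g t) \<in> borel_measurable borel"
  shows "set_lebesgue_integral \<mu> {0..t} (\<lambda>s. g (t - s)) =
     (\<integral>s. indicator {0..} s * (indicator {0..} (t - s) * g (t - s)) \<partial>borel_of_halfline \<mu>)"
proof -
  have "(\<integral>s. indicator {0..} s * (indicator {0..} (t - s) * g (t - s)) \<partial>borel_of_halfline \<mu>)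
      = (\<integral>s. indicator {0..} s * (indicator {0..} (t - s) * g (t - s)) \<partial>\<mu>)"
    unfolding borel_of_halfline_def
    by (rule integral_distr[OF measurable_id_halfline])
       (intro borel_measurable_times measurable_compose[OF _ assms], measurable)
  also have "\<dots> = set_lebesgue_integral \<mu> {0..t} (\<lambda>s. g (t - s))"
    unfolding set_lebesgue_integral_def
    by (rule Bochner_Integration.integral_cong)
       (auto simp: space_halfline_measure indicator_def)
  finally show ?thesis by simp
qed

end

section \<open>Convolution of causal functions\<close>

text \<open>The class of right factors in convolutions; solutions and resolvent belong to it after
  extension by zero, and convolution with a causal weight preserves it.\<close>

definition bounded_causal :: "(real \<Rightarrow> real) \<Rightarrow> bool" where
  "bounded_causal A \<longleftrightarrow> A \<in> borel_measurable borel \<and> (\<forall>t<0. A t = 0) \<and> (\<forall>T. \<exists>C. \<forall>t\<le>T. \<bar>A t\<bar> \<le> C)"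

text \<open>The class of left factors: they may be merely locally integrable, as f is. Pairing them
  with locally bounded right factors makes the convolution integrals absolutely convergent.\<close>

definition causal_weight :: "real measure \<Rightarrow> (real \<Rightarrow> real) \<Rightarrow> bool" where
  "causal_weight M w \<longleftrightarrow> sigma_finite_measure M \<and> sets M = sets borel \<and> w \<in> borel_measurable borel
     \<and> (\<forall>t<0. w t = 0) \<and> (\<forall>T. integrable M (\<lambda>s. indicator {..T} s * w s))"

text \<open>Convolution with the measure \<open>w M\<close>: an ordinary convolution for \<open>M = lborel\<close>, and the convolution
  with a measure \<open>\<mu>\<close> on the half-line for \<open>w = indicator {0..}\<close>, \<open>M = \<mu>\<close>.\<close>

definition wconv :: "real measure \<Rightarrow> (real \<Rightarrow> real) \<Rightarrow> (real \<Rightarrow> real) \<Rightarrow> real \<Rightarrow> real" where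
  "wconv M w A t = (\<integral>u. w u * A (t - u) \<partial>M)"

lemma bounded_causalI:
  assumes "A \<in> borel_measurable borel" "\<And>t. t < 0 \<Longrightarrow> A t = 0"
    "\<And>T. T \<ge> 0 \<Longrightarrow> \<exists>C. \<forall>t\<in>{0..T}. \<bar>A t\<bar> \<le> C"
  shows "bounded_causal A"
  unfolding bounded_causal_def
proof (intro conjI allI impI)
  fix T
  obtain C where C: "\<And>t. t \<in> {0..max 0 T} \<Longrightarrow> \<bar>A t\<bar> \<le> C" using assms(3)[of "max 0 T"]
    by (meson max.cobounded1)
  have "\<bar>A t\<bar> \<le> max 0 C" if "t \<le> T" for t
    using assms(2)[of t] C[of t] that by (cases "t < 0") auto
  then show "\<exists>C. \<forall>t\<le>T. \<bar>A t\<bar> \<le> C" by blast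
qed (use assms in auto)

lemma bounded_causal_measurable: "bounded_causal A \<Longrightarrow> A \<in> borel_measurable borel"
  and bounded_causal_zero: "bounded_causal A \<Longrightarrow> t < 0 \<Longrightarrow> A t = 0"
  by (simp_all add: bounded_causal_def)

lemma bounded_causal_bound:
  assumes "bounded_causal A"
  obtains C where "C \<ge> 0" "\<And>t. t \<le> T \<Longrightarrow> \<bar>A t\<bar> \<le> C"
proof -
  obtain C where C: "\<And>t. t \<le> T \<Longrightarrow> \<bar>A t\<bar> \<le> C" using assms unfolding bounded_causal_def by meson
  moreover from C[of T] have "C \<ge> 0" by simp
  ultimately show ?thesis using that by blast
qed

lemma causal_weight_measurable: "causal_weight M w \<Longrightarrow> w \<in> borel_measurable borel"
  and causal_weight_zero: "causal_weight M w \<Longrightarrow> t < 0 \<Longrightarrow> w t = 0"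
  and causal_weight_integrable: "causal_weight M w \<Longrightarrow> integrable M (\<lambda>s. indicator {..T} s * w s)"
  and causal_weight_sets: "causal_weight M w \<Longrightarrow> sets M = sets borel"
  and causal_weight_sigma_finite: "causal_weight M w \<Longrightarrow> sigma_finite_measure M"
  by (simp_all add: causal_weight_def)

section \<open>Closure properties of the two classes\<close>

lemma bounded_causal_indicator: "bounded_causal (indicator {0..})"
  by (rule bounded_causalI) (auto intro!: exI[of _ 1] simp: indicator_def)

lemma bounded_causal_add:
  assumes "bounded_causal A" "bounded_causal B"
  shows "bounded_causal (\<lambda>t. A t + B t)"
proof (rule bounded_causalI)
  note [measurable] = bounded_causal_measurable[OF assms(1)] bounded_causal_measurable[OF assms(2)]
  show "(\<lambda>t. A t + B t) \<in> borel_measurable borel" by measurable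
  show "A t + B t = 0" if "t < 0" for t using assms that by (simp add: bounded_causal_zero)
  fix T :: real
  obtain C where C: "\<And>t. t \<le> T \<Longrightarrow> \<bar>A t\<bar> \<le> C" using bounded_causal_bound[OF assms(1)] by metis
  obtain D where D: "\<And>t. t \<le> T \<Longrightarrow> \<bar>B t\<bar> \<le> D" using bounded_causal_bound[OF assms(2)] by metis
  show "\<exists>C. \<forall>t\<in>{0..T}. \<bar>A t + B t\<bar> \<le> C"
    by (intro exI[of _ "C + D"] ballI order_trans[OF abs_triangle_ineq] add_mono C D) auto
qed

lemma bounded_causal_cmult:
  assumes "bounded_causal A"
  shows "bounded_causal (\<lambda>t. c * A t)"
proof (rule bounded_causalI)
  note [measurable] = bounded_causal_measurable[OF assms(1)]
  show "(\<lambda>t. c * A t) \<in> borel_measurable borel" by measurable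
  show "c * A t = 0" if "t < 0" for t using assms that by (simp add: bounded_causal_zero)
  fix T :: real
  obtain C where C: "\<And>t. t \<le> T \<Longrightarrow> \<bar>A t\<bar> \<le> C" using bounded_causal_bound[OF assms(1)] by metis
  show "\<exists>C. \<forall>t\<in>{0..T}. \<bar>c * A t\<bar> \<le> C"
    by (intro exI[of _ "\<bar>c\<bar> * C"] ballI) (auto simp: abs_mult C intro!: mult_left_mono)
qed

lemma bounded_causal_diff:
  "bounded_causal A \<Longrightarrow> bounded_causal B \<Longrightarrow> bounded_causal (\<lambda>t. A t - B t)"
  using bounded_causal_add[of A "\<lambda>t. -1 * B t"] bounded_causal_cmult[of B "-1"] by simp

lemma causal_weight_bounded_causal:
  assumes "bounded_causal A"
  shows "causal_weight lborel A"
  unfolding causal_weight_def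
proof (intro conjI allI impI)
  note [measurable] = bounded_causal_measurable[OF assms(1)]
  show "A \<in> borel_measurable borel" by measurable
  fix T
  obtain C where C: "C \<ge> 0" "\<And>t. t \<le> T \<Longrightarrow> \<bar>A t\<bar> \<le> C" using bounded_causal_bound[OF assms(1)] by metis
  have "integrable lborel (\<lambda>s::real. C * indicator {0..T} s)"
    by (intro integrable_mult_right integrable_real_indicator) (auto simp: emeasure_lborel_Icc_eq)
  then show "integrable lborel (\<lambda>s. indicator {..T} s * A s)"
    by (rule Bochner_Integration.integrable_bound)
       (use C in \<open>auto intro!: AE_I2 simp: indicator_def bounded_causal_zero[OF assms] not_le[symmetric]\<close>)
qed (use assms in \<open>auto simp: bounded_causal_zero lborel.sigma_finite_measure_axioms\<close>)

lemma causal_weight_add: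
  assumes "causal_weight M v" "causal_weight M w"
  shows "causal_weight M (\<lambda>t. v t + w t)"
  unfolding causal_weight_def
proof (intro conjI allI impI)
  note [measurable] = causal_weight_measurable[OF assms(1)] causal_weight_measurable[OF assms(2)]
  show "(\<lambda>t. v t + w t) \<in> borel_measurable borel" by measurable
  show "integrable M (\<lambda>s. indicator {..T} s * (v s + w s))" for T
    using Bochner_Integration.integrable_add[OF assms[THEN causal_weight_integrable], of T T]
    by (simp add: distrib_left)
qed (use assms in \<open>auto simp: causal_weight_def\<close>)

lemma causal_weight_finite_measure:
  assumes "finite_measure \<mu>" and [measurable_cong]: "sets \<mu> = sets borel"
  shows "causal_weight \<mu> (indicator {0..})"
  unfolding causal_weight_def
proof (intro conjI allI impI)
  interpret finite_measure \<mu> by fact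
  show "sigma_finite_measure \<mu>" by unfold_locales
  show "integrable \<mu> (\<lambda>s. indicator {..T} s * indicator {0..} s :: real)" for T
    by (rule integrable_const_bound[of _ 1]) (auto simp: indicator_def)
qed (use assms in auto)

text \<open>Only 0 \<le> u \<le> t contributes, and there A (t - u) is bounded while w is
  integrable.\<close>

lemma integrable_wconv:
  assumes w: "causal_weight M w" and A: "bounded_causal A"
  shows "integrable M (\<lambda>u. w u * A (t - u))"
proof -
  note [measurable_cong] = causal_weight_sets[OF w]
  note [measurable] = causal_weight_measurable[OF w] bounded_causal_measurable[OF A]
  obtain C where C: "C \<ge> 0" "\<And>s. s \<le> t \<Longrightarrow> \<bar>A s\<bar> \<le> C" using bounded_causal_bound[OF A] by metis
  have "integrable M (\<lambda>u. C * (indicator {..t} u * w u))"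
    using causal_weight_integrable[OF w, of t] by (rule integrable_mult_right)
  then show ?thesis
  proof (rule Bochner_Integration.integrable_bound)
    show "(\<lambda>u. w u * A (t - u)) \<in> borel_measurable M" by measurable
    have "\<bar>w u * A (t - u)\<bar> \<le> \<bar>C * (indicator {..t} u * w u)\<bar>" for u
    proof (cases "u < 0 \<or> u > t")
      case True
      then show ?thesis using causal_weight_zero[OF w, of u] bounded_causal_zero[OF A, of "t - u"] by auto
    next
      case False
      then show ?thesis using mult_right_mono[OF C(2)[of "t - u"], of "\<bar>w u\<bar>"] C(1)
        by (simp add: abs_mult mult.commute)
    qed
    then show "AE u in M. norm (w u * A (t - u)) \<le> norm (C * (indicator {..t} u * w u))" by simp
  qed
qed

lemma bounded_causal_wconv:
  assumes w: "causal_weight M w" and A: "bounded_causal A"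
  shows "bounded_causal (wconv M w A)"
proof (rule bounded_causalI)
  interpret sigma_finite_measure M using causal_weight_sigma_finite[OF w] .
  note [measurable_cong] = causal_weight_sets[OF w]
  note [measurable] = causal_weight_measurable[OF w] bounded_causal_measurable[OF A]
  show "wconv M w A \<in> borel_measurable borel" unfolding wconv_def by measurable
  show "wconv M w A t = 0" if "t < 0" for t
  proof -
    have "w u * A (t - u) = 0" for u
      using causal_weight_zero[OF w, of u] bounded_causal_zero[OF A, of "t - u"] that
      by (cases "u < 0") auto
    then have "(\<lambda>u. w u * A (t - u)) = (\<lambda>_. 0)" by blast
    then show ?thesis by (simp add: wconv_def)
  qed
  fix T :: real
  obtain C where C: "C \<ge> 0" "\<And>s. s \<le> T \<Longrightarrow> \<bar>A s\<bar> \<le> C" using bounded_causal_bound[OF A] by metis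
  have "\<bar>wconv M w A t\<bar> \<le> (\<integral>u. C * \<bar>indicator {..T} u * w u\<bar> \<partial>M)" if t: "t \<in> {0..T}" for t
  proof -
    have "\<bar>wconv M w A t\<bar> \<le> (\<integral>u. \<bar>w u * A (t - u)\<bar> \<partial>M)"
      unfolding wconv_def by (rule integral_abs_bound)
    also have "\<dots> \<le> (\<integral>u. C * \<bar>indicator {..T} u * w u\<bar> \<partial>M)"
    proof (rule integral_mono)
      show "integrable M (\<lambda>u. \<bar>w u * A (t - u)\<bar>)" using integrable_wconv[OF w A] by simp
      show "integrable M (\<lambda>u. C * \<bar>indicator {..T} u * w u\<bar>)"
        by (intro integrable_mult_right integrable_abs causal_weight_integrable[OF w])
      fix u
      show "\<bar>w u * A (t - u)\<bar> \<le> C * \<bar>indicator {..T} u * w u\<bar>"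
      proof (cases "u < 0 \<or> u > t")
        case True
        then show ?thesis using causal_weight_zero[OF w, of u] bounded_causal_zero[OF A, of "t - u"] C(1) by auto
      next
        case False
        then show ?thesis using mult_right_mono[OF C(2)[of "t - u"], of "\<bar>w u\<bar>"] t
          by (simp add: abs_mult mult.commute)
      qed
    qed
    finally show ?thesis .
  qed
  then show "\<exists>C. \<forall>t\<in>{0..T}. \<bar>wconv M w A t\<bar> \<le> C" by blast
qed

section \<open>Algebra of convolution\<close>

lemma wconv_add_right:
  assumes "causal_weight M w" "bounded_causal A" "bounded_causal B"
  shows "wconv M w (\<lambda>t. A t + B t) = (\<lambda>t. wconv M w A t + wconv M w B t)"
  using integrable_wconv[OF assms(1,2)] integrable_wconv[OF assms(1,3)]
  by (simp add: wconv_def distrib_left fun_eq_iff)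

lemma wconv_diff_right:
  assumes "causal_weight M w" "bounded_causal A" "bounded_causal B"
  shows "wconv M w (\<lambda>t. A t - B t) = (\<lambda>t. wconv M w A t - wconv M w B t)"
  using integrable_wconv[OF assms(1,2)] integrable_wconv[OF assms(1,3)]
  by (simp add: wconv_def right_diff_distrib fun_eq_iff)

lemma wconv_cmult_right: "wconv M w (\<lambda>t. c * A t) = (\<lambda>t. c * wconv M w A t)"
  by (simp add: wconv_def fun_eq_iff mult.left_commute[of _ c])

lemma wconv_add_left:
  assumes "causal_weight M v" "causal_weight M w" "bounded_causal A"
  shows "wconv M (\<lambda>t. v t + w t) A = (\<lambda>t. wconv M v A t + wconv M w A t)"
  using integrable_wconv[OF assms(1,3)] integrable_wconv[OF assms(2,3)]
  by (simp add: wconv_def distrib_right fun_eq_iff)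

text \<open>The reflection u \<mapsto> t - u preserves Lebesgue measure. The identity holds for
  arbitrary A and B, since a non-integrable integrand gives 0 on both sides.\<close>

lemma wconv_lborel_commute: "wconv lborel A B = wconv lborel B A"
proof
  fix t
  show "wconv lborel A B t = wconv lborel B A t"
    unfolding wconv_def
    using lborel_integral_real_affine[of "-1" "\<lambda>u. A u * B (t - u)" t] by (simp add: mult.commute)
qed

text \<open>Fubini's theorem: the integrand vanishes unless u, s \<ge> 0 and u + s \<le> t, so it is
  dominated by a constant times the product of the weights truncated at t. As the two weights may
  belong to different measures, this plays the role of associativity for convolutions with functions
  and with \<nu> alike.\<close>

lemma wconv_wconv_commute:
  assumes v: "causal_weight M v" and w: "causal_weight N w" and A: "bounded_causal A"
  shows "wconv M v (wconv N w A) = wconv N w (wconv M v A)"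
proof
  fix t
  interpret M: sigma_finite_measure M using causal_weight_sigma_finite[OF v] .
  interpret N: sigma_finite_measure N using causal_weight_sigma_finite[OF w] .
  interpret P: pair_sigma_finite M N ..
  note [measurable_cong] = causal_weight_sets[OF v] causal_weight_sets[OF w]
  note [measurable] = causal_weight_measurable[OF v] causal_weight_measurable[OF w] bounded_causal_measurable[OF A]
  obtain C where C: "C \<ge> 0" "\<And>s. s \<le> t \<Longrightarrow> \<bar>A s\<bar> \<le> C" using bounded_causal_bound[OF A] by metis
  define v' where "v' u = indicator {..t} u * v u" for u
  define w' where "w' s = indicator {..t} s * w s" for s
  have [measurable]: "v' \<in> borel_measurable borel" "w' \<in> borel_measurable borel"
    unfolding v'_def w'_def by measurable
  have bnd: "\<bar>v u * (w s * A (t - u - s))\<bar> \<le> C * (\<bar>v' u\<bar> * \<bar>w' s\<bar>)" for u s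
  proof (cases "u < 0 \<or> s < 0 \<or> u + s > t")
    case True
    then show ?thesis
      using causal_weight_zero[OF v, of u] causal_weight_zero[OF w, of s]
        bounded_causal_zero[OF A, of "t - u - s"] C(1) by (auto simp: algebra_simps)
  next
    case False
    then have "\<bar>A (t - u - s)\<bar> * (\<bar>v u\<bar> * \<bar>w s\<bar>) \<le> C * (\<bar>v u\<bar> * \<bar>w s\<bar>)"
      by (intro mult_right_mono C) auto
    moreover have "v' u = v u" "w' s = w s" using False by (auto simp: v'_def w'_def)
    ultimately show ?thesis by (simp add: abs_mult mult_ac)
  qed
  have "integrable (M \<Otimes>\<^sub>M N) (\<lambda>(u, s). v u * (w s * A (t - u - s)))"
  proof (rule integrableI_bounded)
    show "(\<lambda>(u, s). v u * (w s * A (t - u - s))) \<in> borel_measurable (M \<Otimes>\<^sub>M N)" by measurable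
    have "(\<integral>\<^sup>+z. ennreal (norm (case z of (u, s) \<Rightarrow> v u * (w s * A (t - u - s)))) \<partial>(M \<Otimes>\<^sub>M N))
       \<le> (\<integral>\<^sup>+z. ennreal C * (ennreal \<bar>v' (fst z)\<bar> * ennreal \<bar>w' (snd z)\<bar>) \<partial>(M \<Otimes>\<^sub>M N))"
      using bnd C(1) by (intro nn_integral_mono) (auto simp flip: ennreal_mult intro!: ennreal_leI)
    also have "\<dots> = (\<integral>\<^sup>+u. \<integral>\<^sup>+s. ennreal C * (ennreal \<bar>v' u\<bar> * ennreal \<bar>w' s\<bar>) \<partial>N \<partial>M)"
      by (subst N.nn_integral_fst[symmetric]) simp_all
    also have "\<dots> = ennreal C * ((\<integral>\<^sup>+u. ennreal \<bar>v' u\<bar> \<partial>M) * (\<integral>\<^sup>+s. ennreal \<bar>w' s\<bar> \<partial>N))"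
      by (simp add: nn_integral_cmult nn_integral_multc)
    also have "\<dots> < \<infinity>"
    proof -
      have "integrable M v'" "integrable N w'"
        unfolding v'_def w'_def by (intro causal_weight_integrable v w)+
      then show ?thesis by (simp add: integrable_iff_bounded ennreal_mult_less_top)
    qed
    finally show "(\<integral>\<^sup>+z. ennreal (norm (case z of (u, s) \<Rightarrow> v u * (w s * A (t - u - s)))) \<partial>(M \<Otimes>\<^sub>M N)) < \<infinity>" .
  qed
  then have fubini: "(\<integral>s. \<integral>u. v u * (w s * A (t - u - s)) \<partial>M \<partial>N) = (\<integral>u. \<integral>s. v u * (w s * A (t - u - s)) \<partial>N \<partial>M)"
    by (rule P.Fubini_integral)
  have eq: "v u * (w s * A (t - u - s)) = w s * (v u * A (t - s - u))" for u s
    by (simp add: algebra_simps)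
  have "wconv M v (wconv N w A) t = (\<integral>u. \<integral>s. v u * (w s * A (t - u - s)) \<partial>N \<partial>M)"
    by (simp add: wconv_def)
  also have "\<dots> = (\<integral>s. \<integral>u. w s * (v u * A (t - s - u)) \<partial>M \<partial>N)"
    unfolding fubini[symmetric] by (simp only: eq)
  also have "\<dots> = wconv N w (wconv M v A) t"
    by (simp add: wconv_def)
  finally show "wconv M v (wconv N w A) t = wconv N w (wconv M v A) t" .
qed

section \<open>Functions with integrable powers\<close>

text \<open>Convexity: \<open>u powr p\<close> lies above its tangent at k. For p > 1 this is p
  times Young's inequality with the conjugate exponent q = p / (p - 1).\<close>

lemma powr_tangent_le:
  fixes u k p :: real
  assumes "p \<ge> 1" "u \<ge> 0" "k \<ge> 0"
  shows "p * k powr (p - 1) * u \<le> u powr p + (p - 1) * k powr p"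
proof (cases "p = 1")
  case True
  then show ?thesis using assms by auto
next
  case False
  with assms have p: "p > 1" by simp
  define q where "q = p / (p - 1)"
  have "u * k powr (p - 1) \<le> u powr p / p + (k powr (p - 1)) powr q / q"
    by (rule Youngs_inequality) (use p assms in \<open>auto simp: q_def field_simps\<close>)
  also have "(k powr (p - 1)) powr q = k powr p"
    using p by (simp add: powr_powr q_def)
  finally have "p * (u * k powr (p - 1)) \<le> p * (u powr p / p + k powr p / q)"
    using p by (intro mult_left_mono) auto
  also have "\<dots> = u powr p + (p - 1) * k powr p"
    using p by (simp add: q_def field_simps)
  finally show ?thesis by (simp add: mult_ac)
qed

text \<open>Jensen's inequality, from integrating the tangent inequality at the mean k = c / M.
  Taking c and M as one-sided bounds for the integral and the total mass admits an infinite integral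
  and the zero measure.\<close>

lemma Jensen_powr_nn_integral:
  fixes u :: "'a \<Rightarrow> real"
  assumes p: "p \<ge> 1" and c: "c \<ge> 0" and M: "M > 0" "emeasure \<mu> (space \<mu>) \<le> ennreal M"
    and [measurable]: "u \<in> borel_measurable \<mu>"
    and le: "ennreal c \<le> (\<integral>\<^sup>+s. ennreal \<bar>u s\<bar> \<partial>\<mu>)"
  shows "ennreal (c powr p) \<le> ennreal (M powr (p - 1)) * (\<integral>\<^sup>+s. ennreal (\<bar>u s\<bar> powr p) \<partial>\<mu>)"
proof (cases "(\<integral>\<^sup>+s. ennreal (\<bar>u s\<bar> powr p) \<partial>\<mu>) = top")
  case True
  then show ?thesis using M by (simp add: ennreal_mult_top)
next
  case False
  then obtain I where I: "I \<ge> 0" "(\<integral>\<^sup>+s. ennreal (\<bar>u s\<bar> powr p) \<partial>\<mu>) = ennreal I"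
    by (cases "\<integral>\<^sup>+s. ennreal (\<bar>u s\<bar> powr p) \<partial>\<mu>") auto
  define k where "k = c / M"
  have k: "k \<ge> 0" "c = k * M" using c M by (auto simp: k_def)
  define a where "a = p * k powr (p - 1)"
  have a: "a \<ge> 0" using p by (simp add: a_def)
  have "ennreal (a * c) \<le> ennreal a * (\<integral>\<^sup>+s. ennreal \<bar>u s\<bar> \<partial>\<mu>)"
    using le a c by (simp add: ennreal_mult mult_left_mono)
  also have "\<dots> = (\<integral>\<^sup>+s. ennreal (a * \<bar>u s\<bar>) \<partial>\<mu>)"
    using a by (simp add: nn_integral_cmult ennreal_mult)
  also have "\<dots> \<le> (\<integral>\<^sup>+s. ennreal (\<bar>u s\<bar> powr p) + ennreal ((p - 1) * k powr p) \<partial>\<mu>)"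
    using powr_tangent_le[OF p _ k(1)] p
    by (intro nn_integral_mono) (auto simp: a_def simp flip: ennreal_plus intro!: ennreal_leI)
  also have "\<dots> = ennreal I + ennreal ((p - 1) * k powr p) * emeasure \<mu> (space \<mu>)"
    by (simp add: nn_integral_add I)
  also have "\<dots> \<le> ennreal I + ennreal ((p - 1) * k powr p) * ennreal M"
    using M by (intro add_left_mono mult_left_mono) auto
  also have "\<dots> = ennreal (I + (p - 1) * k powr p * M)"
    using I p M by (simp add: ennreal_mult)
  finally have "a * c \<le> I + (p - 1) * k powr p * M"
    using I p M by (subst (asm) ennreal_le_iff) auto
  moreover have "a * c = p * k powr p * M"
  proof -
    have "k powr (p - 1) * k = k powr p"
      using k powr_mult_base[of k "p - 1"] by (simp add: mult.commute)
    then show ?thesis by (simp add: a_def k(2) mult_ac)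
  qed
  ultimately have "k powr p * M \<le> I" by (simp add: algebra_simps)
  then have "M powr (p - 1) * (k powr p * M) \<le> M powr (p - 1) * I"
    by (intro mult_left_mono) auto
  moreover have "c powr p = M powr (p - 1) * (k powr p * M)"
  proof -
    have "M powr (p - 1) * M = M powr p"
      using M powr_mult_base[of M "p - 1"] by (simp add: mult.commute)
    then show ?thesis using k M by (simp add: powr_mult mult_ac)
  qed
  ultimately show ?thesis using I by (simp flip: ennreal_mult add: ennreal_leI)
qed

text \<open>Functions on the half-line enter this space extended by zero, which makes it invariant
  under all translations.\<close>

definition Lp_line :: "real \<Rightarrow> (real \<Rightarrow> real) \<Rightarrow> bool" where
  "Lp_line p g \<longleftrightarrow> g \<in> borel_measurable borel \<and> (\<integral>\<^sup>+t. ennreal (\<bar>g t\<bar> powr p) \<partial>lborel) < \<infinity>"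

lemma Lp_lineI: "g \<in> borel_measurable borel \<Longrightarrow> (\<integral>\<^sup>+t. ennreal (\<bar>g t\<bar> powr p) \<partial>lborel) < \<infinity> \<Longrightarrow> Lp_line p g"
  by (simp add: Lp_line_def)

lemma Lp_line_measurable: "Lp_line p g \<Longrightarrow> g \<in> borel_measurable borel"
  by (simp add: Lp_line_def)

text \<open>A crude substitute for Minkowski's inequality, from
  \<open>\<bar>a + b\<bar> \<le> 2 * max \<bar>a\<bar> \<bar>b\<bar>\<close>.\<close>

lemma abs_add_powr_le:
  fixes a b p :: real assumes "p \<ge> 0"
  shows "\<bar>a + b\<bar> powr p \<le> 2 powr p * (\<bar>a\<bar> powr p + \<bar>b\<bar> powr p)"
proof -
  have "\<bar>a + b\<bar> powr p \<le> (2 * max \<bar>a\<bar> \<bar>b\<bar>) powr p"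
    using assms by (intro powr_mono2) auto
  also have "\<dots> = 2 powr p * (max \<bar>a\<bar> \<bar>b\<bar>) powr p" by (simp add: powr_mult)
  also have "\<dots> \<le> 2 powr p * (\<bar>a\<bar> powr p + \<bar>b\<bar> powr p)"
    by (intro mult_left_mono) (auto simp: max_def)
  finally show ?thesis .
qed

lemma nn_integral_abs_add_powr_le:
  fixes f g :: "'a \<Rightarrow> real"
  assumes "p \<ge> 0" and [measurable]: "f \<in> borel_measurable M" "g \<in> borel_measurable M"
  shows "(\<integral>\<^sup>+t. ennreal (\<bar>f t + g t\<bar> powr p) \<partial>M) \<le>
    ennreal (2 powr p) * ((\<integral>\<^sup>+t. ennreal (\<bar>f t\<bar> powr p) \<partial>M) + (\<integral>\<^sup>+t. ennreal (\<bar>g t\<bar> powr p) \<partial>M))"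
proof -
  have "(\<integral>\<^sup>+t. ennreal (\<bar>f t + g t\<bar> powr p) \<partial>M)
      \<le> (\<integral>\<^sup>+t. ennreal (2 powr p) * (ennreal (\<bar>f t\<bar> powr p) + ennreal (\<bar>g t\<bar> powr p)) \<partial>M)"
    using abs_add_powr_le[OF assms(1)]
    by (intro nn_integral_mono) (simp flip: ennreal_plus ennreal_mult add: ennreal_leI)
  then show ?thesis by (simp add: nn_integral_cmult nn_integral_add)
qed

lemma Lp_line_add:
  assumes p: "p \<ge> 0" and f: "Lp_line p f" and g: "Lp_line p g"
  shows "Lp_line p (\<lambda>t. f t + g t)"
proof (rule Lp_lineI)
  note [measurable] = Lp_line_measurable[OF f] Lp_line_measurable[OF g]
  show "(\<lambda>t. f t + g t) \<in> borel_measurable borel" by measurable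
  have "(\<integral>\<^sup>+t. ennreal (\<bar>f t + g t\<bar> powr p) \<partial>lborel) \<le>
    ennreal (2 powr p) * ((\<integral>\<^sup>+t. ennreal (\<bar>f t\<bar> powr p) \<partial>lborel) + (\<integral>\<^sup>+t. ennreal (\<bar>g t\<bar> powr p) \<partial>lborel))"
    using p by (intro nn_integral_abs_add_powr_le) measurable
  also have "\<dots> < \<infinity>" using f g by (simp add: Lp_line_def ennreal_mult_less_top)
  finally show "(\<integral>\<^sup>+t. ennreal (\<bar>f t + g t\<bar> powr p) \<partial>lborel) < \<infinity>" .
qed

lemma Lp_line_cmult:
  assumes f: "Lp_line p f"
  shows "Lp_line p (\<lambda>t. c * f t)"
proof (rule Lp_lineI)
  note [measurable] = Lp_line_measurable[OF f]
  show "(\<lambda>t. c * f t) \<in> borel_measurable borel" by measurable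
  have "(\<integral>\<^sup>+t. ennreal (\<bar>c * f t\<bar> powr p) \<partial>lborel) = ennreal (\<bar>c\<bar> powr p) * (\<integral>\<^sup>+t. ennreal (\<bar>f t\<bar> powr p) \<partial>lborel)"
    by (simp add: abs_mult powr_mult ennreal_mult nn_integral_cmult)
  then show "(\<integral>\<^sup>+t. ennreal (\<bar>c * f t\<bar> powr p) \<partial>lborel) < \<infinity>"
    using f by (simp add: Lp_line_def ennreal_mult_less_top)
qed

lemma Lp_line_diff:
  assumes "p \<ge> 0" "Lp_line p f" "Lp_line p g"
  shows "Lp_line p (\<lambda>t. f t - g t)"
  using Lp_line_add[OF assms(1,2) Lp_line_cmult[OF assms(3), of "-1"]] by simp

text \<open>Minkowski's integral inequality up to a constant: Jensen in s, then Tonelli, then the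
  bound K common to almost all sections. It yields both Young's inequality and the estimate of
  averaged shift differences.\<close>

lemma Lp_line_averaged:
  fixes k :: "real \<Rightarrow> 'a \<Rightarrow> real"
  assumes p: "p \<ge> 1" and \<mu>: "finite_measure \<mu>"
    and k[measurable]: "case_prod k \<in> borel_measurable (borel \<Otimes>\<^sub>M \<mu>)"
    and h[measurable]: "h \<in> borel_measurable borel"
    and le: "\<And>t. ennreal \<bar>h t\<bar> \<le> (\<integral>\<^sup>+s. ennreal \<bar>k t s\<bar> \<partial>\<mu>)"
    and K: "AE s in \<mu>. (\<integral>\<^sup>+t. ennreal (\<bar>k t s\<bar> powr p) \<partial>lborel) \<le> K" "K < \<infinity>"
  shows "Lp_line p h"
proof (rule Lp_lineI)
  interpret \<mu>: finite_measure \<mu> by fact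
  interpret P: pair_sigma_finite lborel \<mu> ..
  \<comment> \<open>Adding 1 keeps M positive even if \<mu> is the zero measure.\<close>
  define M where "M = measure \<mu> (space \<mu>) + 1"
  have M: "M > 0" "emeasure \<mu> (space \<mu>) \<le> ennreal M"
    by (auto simp: M_def \<mu>.emeasure_eq_measure add_nonneg_pos intro!: ennreal_leI)
  have k'[measurable]: "case_prod k \<in> borel_measurable (lborel \<Otimes>\<^sub>M \<mu>)"
    by (subst measurable_cong_sets[OF sets_pair_measure_cong[OF sets_lborel refl] refl]) (rule k)
  have "(\<integral>\<^sup>+t. ennreal (\<bar>h t\<bar> powr p) \<partial>lborel)
     \<le> (\<integral>\<^sup>+t. ennreal (M powr (p - 1)) * (\<integral>\<^sup>+s. ennreal (\<bar>k t s\<bar> powr p) \<partial>\<mu>) \<partial>lborel)"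
    by (intro nn_integral_mono Jensen_powr_nn_integral p M le) auto
  also have "\<dots> = ennreal (M powr (p - 1)) * (\<integral>\<^sup>+t. (\<integral>\<^sup>+s. ennreal (\<bar>k t s\<bar> powr p) \<partial>\<mu>) \<partial>lborel)"
    by (rule nn_integral_cmult) measurable
  also have "(\<integral>\<^sup>+t. (\<integral>\<^sup>+s. ennreal (\<bar>k t s\<bar> powr p) \<partial>\<mu>) \<partial>lborel)
     = (\<integral>\<^sup>+s. (\<integral>\<^sup>+t. ennreal (\<bar>k t s\<bar> powr p) \<partial>lborel) \<partial>\<mu>)"
    by (rule P.Fubini'[symmetric]) measurable
  also have "\<dots> \<le> (\<integral>\<^sup>+s. K \<partial>\<mu>)" by (rule nn_integral_mono_AE) (rule K)
  also have "\<dots> = K * emeasure \<mu> (space \<mu>)" by simp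
  finally have "(\<integral>\<^sup>+t. ennreal (\<bar>h t\<bar> powr p) \<partial>lborel)
      \<le> ennreal (M powr (p - 1)) * (K * emeasure \<mu> (space \<mu>))" by (simp add: mult_left_mono)
  also have "\<dots> < \<infinity>"
    using K(2) by (simp add: ennreal_mult_less_top \<mu>.emeasure_eq_measure)
  finally show "(\<integral>\<^sup>+t. ennreal (\<bar>h t\<bar> powr p) \<partial>lborel) < \<infinity>" .
qed fact

lemma nn_integral_lborel_translate:
  fixes g :: "real \<Rightarrow> ennreal"
  assumes [measurable]: "g \<in> borel_measurable borel"
  shows "(\<integral>\<^sup>+t. g (t + c) \<partial>lborel) = (\<integral>\<^sup>+t. g t \<partial>lborel)"
  using nn_integral_real_affine[of g 1 c] by (simp add: add.commute)

text \<open>A non-integrable u has integral 0, so convolutions can be estimated without first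
  proving that they converge.\<close>

lemma ennreal_abs_integral_le:
  fixes u :: "'a \<Rightarrow> real"
  shows "ennreal \<bar>\<integral>s. u s \<partial>\<mu>\<bar> \<le> (\<integral>\<^sup>+s. ennreal \<bar>u s\<bar> \<partial>\<mu>)"
proof (cases "integrable \<mu> u")
  case True
  then show ?thesis using integral_norm_bound_ennreal[OF True] by simp
qed (simp add: not_integrable_integral_eq)

text \<open>Common core of the two forms of Young's inequality: all translates of g have the same
  p-th power integral, which serves as K.\<close>

lemma Lp_line_shift_average:
  assumes p: "p \<ge> 1" and \<mu>: "finite_measure \<mu>" and [measurable_cong]: "sets \<mu> = sets borel"
    and g: "Lp_line p g" and [measurable]: "h \<in> borel_measurable borel"
    and le: "\<And>t. ennreal \<bar>h t\<bar> \<le> (\<integral>\<^sup>+s. ennreal \<bar>g (t - s)\<bar> \<partial>\<mu>)"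
  shows "Lp_line p h"
proof (rule Lp_line_averaged[OF p \<mu> _ _ le])
  note [measurable] = Lp_line_measurable[OF g]
  have "(\<integral>\<^sup>+t. ennreal (\<bar>g (t - s)\<bar> powr p) \<partial>lborel) = (\<integral>\<^sup>+t. ennreal (\<bar>g t\<bar> powr p) \<partial>lborel)" for s
    using nn_integral_lborel_translate[of "\<lambda>t. ennreal (\<bar>g t\<bar> powr p)" "-s"] by simp
  then show "AE s in \<mu>. (\<integral>\<^sup>+t. ennreal (\<bar>g (t - s)\<bar> powr p) \<partial>lborel) \<le> (\<integral>\<^sup>+t. ennreal (\<bar>g t\<bar> powr p) \<partial>lborel)"
    by simp
  show "(\<lambda>(t, s). g (t - s)) \<in> borel_measurable (borel \<Otimes>\<^sub>M \<mu>)" by measurable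
  show "(\<integral>\<^sup>+t. ennreal (\<bar>g t\<bar> powr p) \<partial>lborel) < \<infinity>" using g by (simp add: Lp_line_def)
qed fact

lemma Lp_line_translate:
  assumes "Lp_line p g"
  shows "Lp_line p (\<lambda>t. g (t + c))"
  using assms nn_integral_lborel_translate[of "\<lambda>t. ennreal (\<bar>g t\<bar> powr p)" c]
  unfolding Lp_line_def by auto

lemma Lp_line_mono:
  assumes "p \<ge> 0" "Lp_line p g" "h \<in> borel_measurable borel" "\<And>t. \<bar>h t\<bar> \<le> \<bar>g t\<bar>"
  shows "Lp_line p h"
proof (rule Lp_lineI)
  have "(\<integral>\<^sup>+t. ennreal (\<bar>h t\<bar> powr p) \<partial>lborel) \<le> (\<integral>\<^sup>+t. ennreal (\<bar>g t\<bar> powr p) \<partial>lborel)"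
    by (intro nn_integral_mono ennreal_leI powr_mono2) (use assms in auto)
  also have "\<dots> < \<infinity>" using assms(2) by (simp add: Lp_line_def)
  finally show "(\<integral>\<^sup>+t. ennreal (\<bar>h t\<bar> powr p) \<partial>lborel) < \<infinity>" .
qed fact

lemma Lp_line_bounded_support:
  assumes "p \<ge> 0" "h \<in> borel_measurable borel" "\<And>t. \<bar>h t\<bar> \<le> C" "\<And>t. t \<notin> {a..b} \<Longrightarrow> h t = 0"
  shows "Lp_line p h"
proof (rule Lp_lineI)
  have "(\<integral>\<^sup>+t. ennreal (\<bar>h t\<bar> powr p) \<partial>lborel) \<le> (\<integral>\<^sup>+t. ennreal (C powr p) * indicator {a..b} t \<partial>lborel)"
    using assms by (intro nn_integral_mono) (auto simp: indicator_def intro!: ennreal_leI powr_mono2)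
  also have "\<dots> < \<infinity>"
    by (simp add: nn_integral_cmult ennreal_mult_less_top emeasure_lborel_Icc_eq)
  finally show "(\<integral>\<^sup>+t. ennreal (\<bar>h t\<bar> powr p) \<partial>lborel) < \<infinity>" .
qed fact

lemma Lp_line_of_L1_bounded:
  assumes p: "p \<ge> 1" and g: "Lp_line 1 g" and C: "\<And>t. \<bar>g t\<bar> \<le> C"
  shows "Lp_line p g"
proof (rule Lp_lineI)
  note [measurable] = Lp_line_measurable[OF g]
  show "g \<in> borel_measurable borel" by measurable
  have *: "\<bar>g t\<bar> powr p \<le> C powr (p - 1) * \<bar>g t\<bar> powr 1" for t
  proof -
    have "\<bar>g t\<bar> powr p = \<bar>g t\<bar> powr (p - 1) * \<bar>g t\<bar> powr 1"
      using powr_add[of "\<bar>g t\<bar>" "p - 1" 1] by simp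
    also have "\<dots> \<le> C powr (p - 1) * \<bar>g t\<bar> powr 1"
      using C p by (intro mult_right_mono powr_mono2) auto
    finally show ?thesis .
  qed
  have "(\<integral>\<^sup>+t. ennreal (\<bar>g t\<bar> powr p) \<partial>lborel) \<le> (\<integral>\<^sup>+t. ennreal (C powr (p - 1)) * ennreal (\<bar>g t\<bar> powr 1) \<partial>lborel)"
    using * by (intro nn_integral_mono) (simp flip: ennreal_mult add: ennreal_leI)
  also have "\<dots> = ennreal (C powr (p - 1)) * (\<integral>\<^sup>+t. ennreal (\<bar>g t\<bar> powr 1) \<partial>lborel)"
    by (rule nn_integral_cmult) measurable
  also have "\<dots> < \<infinity>" using g by (simp add: Lp_line_def ennreal_mult_less_top)
  finally show "(\<integral>\<^sup>+t. ennreal (\<bar>g t\<bar> powr p) \<partial>lborel) < \<infinity>" .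
qed

lemma Lp_line_1_iff_integrable: "Lp_line 1 g \<longleftrightarrow> integrable lborel g"
  by (auto simp: Lp_line_def integrable_iff_bounded)

lemma Lp_line_wconv_finite:
  assumes p: "p \<ge> 1" and \<mu>: "finite_measure \<mu>" and sets[measurable_cong]: "sets \<mu> = sets borel"
    and g: "Lp_line p g"
  shows "Lp_line p (wconv \<mu> (indicator {0..}) g)"
proof (rule Lp_line_shift_average[OF p \<mu> sets g])
  interpret finite_measure \<mu> by fact
  note [measurable] = Lp_line_measurable[OF g]
  show "wconv \<mu> (indicator {0..}) g \<in> borel_measurable borel" unfolding wconv_def by measurable
  show "ennreal \<bar>wconv \<mu> (indicator {0..}) g t\<bar> \<le> (\<integral>\<^sup>+s. ennreal \<bar>g (t - s)\<bar> \<partial>\<mu>)" for t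
    unfolding wconv_def
    by (rule order_trans[OF ennreal_abs_integral_le nn_integral_mono])
       (auto simp: indicator_def intro!: ennreal_leI)
qed

text \<open>Young's inequality for L^1 and L^p: absorbing the modulus of w into a finite measure
  bounds the convolution by an average of translates of g.\<close>

lemma Lp_line_wconv_lborel:
  assumes p: "p \<ge> 1" and w: "Lp_line 1 w" and g: "Lp_line p g"
  shows "Lp_line p (wconv lborel w g)"
proof (rule Lp_line_shift_average[OF p _ _ g])
  note [measurable] = Lp_line_measurable[OF g] Lp_line_measurable[OF w]
  let ?\<mu> = "density lborel (\<lambda>s. ennreal \<bar>w s\<bar>)"
  show "finite_measure ?\<mu>"
    using w by (intro finite_measureI) (simp add: emeasure_density Lp_line_def)
  show "sets ?\<mu> = sets borel" by simp
  have [measurable]: "(\<lambda>t. w (snd t)) \<in> borel_measurable (borel \<Otimes>\<^sub>M lborel)" by measurable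
  show "wconv lborel w g \<in> borel_measurable borel" unfolding wconv_def by measurable
  fix t
  have "ennreal \<bar>wconv lborel w g t\<bar> \<le> (\<integral>\<^sup>+s. ennreal \<bar>w s * g (t - s)\<bar> \<partial>lborel)"
    unfolding wconv_def by (rule ennreal_abs_integral_le)
  also have "\<dots> = (\<integral>\<^sup>+s. ennreal \<bar>g (t - s)\<bar> \<partial>?\<mu>)"
    by (simp add: nn_integral_density abs_mult ennreal_mult)
  finally show "ennreal \<bar>wconv lborel w g t\<bar> \<le> \<dots>" .
qed

section \<open>From the half-line to the line\<close>

lemma Lp_halfline_cong:
  assumes "\<And>t. t \<ge> 0 \<Longrightarrow> g t = h t"
  shows "Lp_halfline p g \<longleftrightarrow> Lp_halfline p h"
proof -
  have "(\<lambda>t. indicator {0..} t *\<^sub>R g t) = (\<lambda>t. indicator {0..} t *\<^sub>R h t)"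
    "(\<lambda>t. indicator {0..} t *\<^sub>R \<bar>g t\<bar> powr p) = (\<lambda>t. indicator {0..} t *\<^sub>R \<bar>h t\<bar> powr p)"
    using assms by (auto simp: indicator_def fun_eq_iff)
  then show ?thesis
    by (simp only: Lp_halfline_def set_borel_measurable_def set_integrable_def)
qed

text \<open>For Borel functions, integrability over the completed measure and over Borel sets agree;
  this links the notions of the theorem to the estimates on the line.\<close>

lemma Lp_halfline_iff_Lp_line:
  assumes [measurable]: "(\<lambda>t. indicator {0..} t * g t) \<in> borel_measurable borel"
  shows "Lp_halfline p g \<longleftrightarrow> Lp_line p (\<lambda>t. indicator {0..} t * g t)"
proof -
  have eq: "indicator {0..} t *\<^sub>R (\<bar>g t\<bar> powr p) = \<bar>indicator {0..} t * g t\<bar> powr p" for t :: real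
    by (auto simp: indicator_def)
  have "set_borel_measurable lebesgue {0..} g"
    unfolding set_borel_measurable_def by (auto intro: measurable_completion)
  moreover have "set_integrable lebesgue {0..} (\<lambda>t. \<bar>g t\<bar> powr p) \<longleftrightarrow>
      integrable lborel (\<lambda>t. \<bar>indicator {0..} t * g t\<bar> powr p)"
    unfolding set_integrable_def eq by (rule integrable_completion) measurable
  moreover have "\<dots> \<longleftrightarrow> (\<integral>\<^sup>+t. ennreal (\<bar>indicator {0..} t * g t\<bar> powr p) \<partial>lborel) < \<infinity>"
    by (auto simp: integrable_iff_bounded)
  ultimately show ?thesis by (simp add: Lp_halfline_def Lp_line_def)
qed

section \<open>Primitives of causal functions\<close>

text \<open>Convolution with the Heaviside function is the primitive, so primitives obey the
  commutation laws of convolution.\<close>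

lemma wconv_indicator_eq:
  assumes "causal_weight lborel w"
  shows "wconv lborel w (indicator {0..}) t = (\<integral>u. indicator {0..t} u * w u \<partial>lborel)"
  unfolding wconv_def
  by (rule Bochner_Integration.integral_cong)
     (auto simp: indicator_def causal_weight_zero[OF assms])

lemma causal_weight_integrable_Icc:
  assumes "causal_weight lborel w"
  shows "integrable lborel (\<lambda>u. indicator {a..b} u * w u)"
proof (rule Bochner_Integration.integrable_bound[OF causal_weight_integrable[OF assms, of b]])
  note [measurable] = causal_weight_measurable[OF assms]
  show "(\<lambda>u. indicator {a..b} u * w u) \<in> borel_measurable lborel" by measurable
qed (auto simp: indicator_def)

lemma wconv_indicator_diff:
  assumes w: "causal_weight lborel w" and ab: "a \<le> b"
  shows "wconv lborel w (indicator {0..}) b - wconv lborel w (indicator {0..}) a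
     = (\<integral>u. indicator {a..b} u * w u \<partial>lborel)"
proof -
  note [measurable] = causal_weight_measurable[OF w]
  have "(\<integral>u. indicator {a..b} u * w u \<partial>lborel)
      = (\<integral>u. indicator {0..b} u * w u - indicator {0..a} u * w u \<partial>lborel)"
  proof (rule integral_cong_AE)
    \<comment> \<open>The identity can fail only at u = a, where the closed intervals
      overlap.\<close>
    show "AE u in lborel. indicator {a..b} u * w u = indicator {0..b} u * w u - indicator {0..a} u * w u"
      using AE_lborel_singleton[of a]
    proof eventually_elim
      case (elim u)
      then show ?case using ab causal_weight_zero[OF w, of u] by (auto simp: indicator_def)
    qed
  qed measurable
  then show ?thesis
    by (simp add: wconv_indicator_eq[OF w] causal_weight_integrable_Icc[OF w])
qed

lemma wconv_indicator_eq_integral: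
  assumes w: "causal_weight lborel w"
  shows "wconv lborel w (indicator {0..}) t = integral {0..t} w" and "w integrable_on {a..b}"
proof -
  have "set_integrable lborel {a..b} w" for a b
    using causal_weight_integrable_Icc[OF w] by (simp add: set_integrable_def)
  note * = set_borel_integral_eq_integral[OF this]
  show "w integrable_on {a..b}" by (rule *)
  show "wconv lborel w (indicator {0..}) t = integral {0..t} w"
    using *(2)[of 0 t] by (simp add: wconv_indicator_eq[OF w] set_lebesgue_integral_def)
qed

lemma continuous_on_wconv_indicator:
  assumes w: "causal_weight lborel w"
  shows "continuous_on UNIV (wconv lborel w (indicator {0..}))"
proof -
  let ?F = "wconv lborel w (indicator {0..})"
  have "isCont ?F t" for t
  proof -
    define n where "n = \<bar>t\<bar> + 1"
    have "continuous_on {-n..n} (\<lambda>s. integral {-n..s} w)"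
      by (rule indefinite_integral_continuous_1) (rule wconv_indicator_eq_integral(2)[OF w])
    then have "continuous_on {-n..n} (\<lambda>s. integral {-n..s} w + ?F (-n))"
      by (intro continuous_intros)
    moreover have "integral {-n..s} w + ?F (-n) = ?F s" if "s \<in> {-n..n}" for s
    proof -
      have "set_integrable lborel {-n..s} w"
        using causal_weight_integrable_Icc[OF w] by (simp add: set_integrable_def)
      from set_borel_integral_eq_integral(2)[OF this]
      show ?thesis using wconv_indicator_diff[OF w, of "-n" s] that
        by (simp add: set_lebesgue_integral_def)
    qed
    ultimately have "continuous_on {-n..n} ?F" by (rule continuous_on_eq)
    moreover have "t \<in> interior {-n..n}" by (auto simp: n_def)
    ultimately show ?thesis by (rule continuous_on_interior)
  qed
  then show ?thesis by (simp add: continuous_at_imp_continuous_on)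
qed

text \<open>The convolution calculus works with Borel functions, while f is only Lebesgue
  measurable. As a pointwise limit of its truncations, f cut off at 0 is measurable and so agrees
  almost everywhere with a Borel function.\<close>

lemma L1_loc_halfline_borel_version:
  assumes f: "L1_loc_halfline f"
  obtains f0 where "causal_weight lborel f0" "AE t in lebesgue. 0 \<le> t \<longrightarrow> f t = f0 t"
proof -
  have int: "integrable lebesgue (\<lambda>t. indicator {0..T} t * f t)" for T :: real
  proof (cases "T \<ge> 0")
    case True
    then show ?thesis using f by (simp add: L1_loc_halfline_def set_integrable_def)
  next
    case False
    then have "(\<lambda>t. indicator {0..T} t * f t) = (\<lambda>_. 0)" by (auto simp: indicator_def)
    then show ?thesis by simp
  qed
  have "(\<lambda>t. indicator {0..} t * f t) \<in> borel_measurable lebesgue"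
  proof (rule borel_measurable_LIMSEQ_real)
    fix t :: real
    have "eventually (\<lambda>n. indicator {0..real n} t * f t = indicator {0..} t * f t) sequentially"
      using eventually_ge_at_top[of "nat \<lceil>t\<rceil>"]
      by eventually_elim (auto simp: indicator_def nat_le_iff ceiling_le_iff)
    then show "(\<lambda>n. indicator {0..real n} t * f t) \<longlonglongrightarrow> indicator {0..} t * f t"
      by (rule tendsto_eventually)
  qed (use int in auto)
  then obtain g where g: "g \<in> borel_measurable lborel"
      "AE t in lborel. indicator {0..} t * f t = g t"
    by (auto dest: completion_ex_borel_measurable_real)
  define f0 where "f0 t = indicator {0..} t * g t" for t
  have [measurable]: "f0 \<in> borel_measurable borel" using g(1) unfolding f0_def by simp
  have ae: "AE t in lebesgue. 0 \<le> t \<longrightarrow> f t = f0 t"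
    using AE_completion[OF g(2)] by eventually_elim (auto simp: f0_def)
  have "integrable lborel (\<lambda>s. indicator {..T} s * f0 s)" for T
  proof -
    have "integrable lebesgue (\<lambda>s. indicator {..T} s * f0 s)"
    proof (rule integrable_cong_AE_imp[OF int[of T]])
      show "(\<lambda>s. indicator {..T} s * f0 s) \<in> borel_measurable lebesgue"
        by (rule measurable_completion) measurable
      show "AE t in lebesgue. indicator {0..T} t * f t = indicator {..T} t * f0 t"
        using ae by eventually_elim (auto simp: f0_def indicator_def)
    qed
    then show ?thesis by (subst (asm) integrable_completion) auto
  qed
  then have "causal_weight lborel f0"
    by (auto simp: causal_weight_def lborel.sigma_finite_measure_axioms f0_def)
  then show ?thesis using ae that by blast
qed

lemma set_integral_lebesgue_borel_version:
  assumes f0: "causal_weight lborel f0" and ae: "AE t in lebesgue. 0 \<le> t \<longrightarrow> f t = f0 t"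
    and ab: "0 \<le> a" "a \<le> b"
    and int: "integrable lebesgue (\<lambda>t. indicator {a..b} t * f t)"
  shows "set_lebesgue_integral lebesgue {a..b} f
     = wconv lborel f0 (indicator {0..}) b - wconv lborel f0 (indicator {0..}) a"
proof -
  note [measurable] = causal_weight_measurable[OF f0]
  have "set_lebesgue_integral lebesgue {a..b} f = (\<integral>t. indicator {a..b} t * f0 t \<partial>lebesgue)"
    unfolding set_lebesgue_integral_def
  proof (rule integral_cong_AE)
    show "(\<lambda>t. indicator {a..b} t *\<^sub>R f t) \<in> borel_measurable lebesgue" using int by auto
    show "(\<lambda>t. indicator {a..b} t * f0 t) \<in> borel_measurable lebesgue"
      by (rule measurable_completion) measurable
    show "AE t in lebesgue. indicator {a..b} t *\<^sub>R f t = indicator {a..b} t * f0 t"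
      using ae by eventually_elim (use ab in \<open>auto simp: indicator_def\<close>)
  qed
  also have "\<dots> = (\<integral>t. indicator {a..b} t * f0 t \<partial>lborel)"
    by (rule integral_completion) measurable
  finally show ?thesis by (simp add: wconv_indicator_diff[OF f0 ab(2)])
qed

lemma bounded_causal_locally_abs_continuous:
  assumes x: "locally_abs_continuous_halfline x"
  shows "bounded_causal (\<lambda>t. indicator {0..} t * x t)"
proof (rule bounded_causalI)
  have cont: "continuous_on {0..T} x" if "T \<ge> 0" for T
    using x that by (auto simp: locally_abs_continuous_halfline_def intro: abs_continuous_on_imp_continuous_on)
  have "continuous_on {0..} x"
    unfolding continuous_on_eq_continuous_within
  proof
    fix t :: real assume t: "t \<in> {0..}"
    have "continuous (at t within {0..t+1}) x"
      using cont[of "t + 1"] t by (simp add: continuous_on_eq_continuous_within)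
    moreover have "at t within {0..} = at t within {0..t+1}"
      by (rule at_within_nhd[of _ "{t - 1 <..< t + 1}"]) auto
    ultimately show "continuous (at t within {0..}) x" by simp
  qed
  then show "(\<lambda>t. indicator {0..} t * x t) \<in> borel_measurable borel"
    using borel_measurable_continuous_on_indicator[of "{0..}" x] by simp
  show "\<exists>C. \<forall>t\<in>{0..T}. \<bar>indicator {0..} t * x t\<bar> \<le> C" if T: "T \<ge> 0" for T
  proof -
    have "bounded (x ` {0..T})"
      by (intro compact_imp_bounded compact_continuous_image cont T) simp
    then obtain C where "\<forall>y\<in>x ` {0..T}. norm y \<le> C" unfolding bounded_iff by blast
    then show ?thesis by (intro exI[of _ C]) (auto simp: indicator_def)
  qed
qed auto

text \<open>The passage from the differential to the integral form, by the fundamental theorem for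
  absolutely continuous functions.\<close>

lemma locally_abs_continuous_eq_integral:
  assumes x: "locally_abs_continuous_halfline x"
    and deriv: "AE t in lebesgue. t > 0 \<longrightarrow> (x has_real_derivative g t) (at t)"
    and g0: "causal_weight lborel g0" and ae: "AE t in lebesgue. 0 \<le> t \<longrightarrow> g t = g0 t"
    and t: "t \<ge> 0"
  shows "x t = x 0 + wconv lborel g0 (indicator {0..}) t"
proof -
  have "AE t in lebesgue. t > 0 \<longrightarrow> (x has_real_derivative g0 t) (at t)"
    using deriv ae by eventually_elim auto
  then obtain N where N: "N \<in> null_sets lebesgue"
      "\<And>t. t \<notin> N \<Longrightarrow> t > 0 \<Longrightarrow> (x has_real_derivative g0 t) (at t)"
    unfolding eventually_ae_filter by auto
  \<comment> \<open>The derivative is known only for positive times, so the endpoint 0 joins the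
    exceptional set.\<close>
  have "negligible (insert 0 N)" using N(1) by (simp add: negligible_iff_null_sets)
  moreover have "abs_continuous_on {0..t} x" using x t by (simp add: locally_abs_continuous_halfline_def)
  moreover have "(x has_real_derivative g0 s) (at s within {0..t})" if "s \<in> {0..t} - insert 0 N" for s
    by (rule has_field_derivative_at_within, rule N(2)) (use that in auto)
  ultimately have "(g0 has_integral (x t - x 0)) {0..t}"
    by (intro has_integral_derivative_abs_continuous[OF t])
  then have "integral {0..t} g0 = x t - x 0" by (rule integral_unique)
  then show ?thesis by (simp add: wconv_indicator_eq_integral(1)[OF g0])
qed

section \<open>Uniform boundedness of differences\<close>

text \<open>The increment over u + v telescopes, and a translation turns its second piece into S v.
  The second estimate reads u as (a + u) - a; it carries bounds on shifts in an interval starting at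
  a over to shifts near 0.\<close>

lemma nn_integral_shift_difference_le:
  fixes F :: "real \<Rightarrow> real" and p :: real
  defines "S \<equiv> \<lambda>v. \<integral>\<^sup>+t. ennreal (\<bar>F t - F (t - v)\<bar> powr p) \<partial>lborel"
  assumes p: "p \<ge> 0" and [measurable]: "F \<in> borel_measurable borel"
  shows "S (u + v) \<le> ennreal (2 powr p) * (S u + S v)" "S u \<le> ennreal (2 powr p) * (S (a + u) + S a)"
proof -
  have tr: "(\<integral>\<^sup>+t. ennreal (\<bar>F (t - c) - F (t - c - v)\<bar> powr p) \<partial>lborel) = S v" for c v
    using nn_integral_lborel_translate[of "\<lambda>t. ennreal (\<bar>F t - F (t - v)\<bar> powr p)" "-c"]
    by (simp add: S_def)
  have "S (u + v) = (\<integral>\<^sup>+t. ennreal (\<bar>(F t - F (t - u)) + (F (t - u) - F (t - u - v))\<bar> powr p) \<partial>lborel)"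
    by (simp add: S_def diff_diff_eq)
  also have "\<dots> \<le> ennreal (2 powr p) * (S u + S v)"
    using nn_integral_abs_add_powr_le[OF p, of "\<lambda>t. F t - F (t - u)" lborel "\<lambda>t. F (t - u) - F (t - u - v)"]
    by (simp add: tr) (simp add: S_def)
  finally show "S (u + v) \<le> ennreal (2 powr p) * (S u + S v)" .
  have "S u = (\<integral>\<^sup>+t. ennreal (\<bar>(F t - F (t - (a + u))) + - (F (t - u) - F (t - u - a))\<bar> powr p) \<partial>lborel)"
    by (simp add: S_def algebra_simps)
  also have "\<dots> \<le> ennreal (2 powr p) * (S (a + u) +
      (\<integral>\<^sup>+t. ennreal (\<bar>- (F (t - u) - F (t - u - a))\<bar> powr p) \<partial>lborel))"
    unfolding S_def by (rule nn_integral_abs_add_powr_le[OF p]) measurable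
  also have "(\<integral>\<^sup>+t. ennreal (\<bar>- (F (t - u) - F (t - u - a))\<bar> powr p) \<partial>lborel) = S a"
    unfolding abs_minus_cancel by (rule tr)
  finally show "S u \<le> ennreal (2 powr p) * (S (a + u) + S a)" .
qed

lemma closed_shift_difference_sublevel:
  fixes F :: "real \<Rightarrow> real" and p :: real
  assumes p: "p \<ge> 1" and F: "continuous_on UNIV F"
  shows "closed {v \<in> {0..1}. (\<integral>\<^sup>+t. ennreal (\<bar>F t - F (t - v)\<bar> powr p) \<partial>lborel) \<le> ennreal c}"
  unfolding closed_sequential_limits
proof (intro allI impI, elim conjE)
  fix v :: "nat \<Rightarrow> real" and l
  assume v: "\<forall>n. v n \<in> {v \<in> {0..1}. (\<integral>\<^sup>+t. ennreal (\<bar>F t - F (t - v)\<bar> powr p) \<partial>lborel) \<le> ennreal c}"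
    and lim: "v \<longlonglongrightarrow> l"
  have [measurable]: "F \<in> borel_measurable borel" using F by (rule borel_measurable_continuous_onI)
  have "l \<in> {0..1}" using closed_sequentially[of "{0..1}" v l] v lim by auto
  moreover have "(\<integral>\<^sup>+t. ennreal (\<bar>F t - F (t - l)\<bar> powr p) \<partial>lborel) \<le> ennreal c"
  proof -
    have lim': "(\<lambda>n. ennreal (\<bar>F t - F (t - v n)\<bar> powr p)) \<longlonglongrightarrow> ennreal (\<bar>F t - F (t - l)\<bar> powr p)" for t
    proof -
      have "(\<lambda>n. F (t - v n)) \<longlonglongrightarrow> F (t - l)"
        by (rule continuous_on_tendsto_compose[OF F]) (auto intro!: tendsto_intros lim)
      then have "(\<lambda>n. \<bar>F t - F (t - v n)\<bar>) \<longlonglongrightarrow> \<bar>F t - F (t - l)\<bar>"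
        by (intro tendsto_intros)
      then have "(\<lambda>n. \<bar>F t - F (t - v n)\<bar> powr p) \<longlonglongrightarrow> \<bar>F t - F (t - l)\<bar> powr p"
        by (rule tendsto_powr') (use p in auto)
      then show ?thesis by (rule tendsto_ennrealI)
    qed
    have "(\<integral>\<^sup>+t. ennreal (\<bar>F t - F (t - l)\<bar> powr p) \<partial>lborel)
       = (\<integral>\<^sup>+t. liminf (\<lambda>n. ennreal (\<bar>F t - F (t - v n)\<bar> powr p)) \<partial>lborel)"
      using lim_imp_Liminf[OF _ lim'] by simp
    also have "\<dots> \<le> liminf (\<lambda>n. \<integral>\<^sup>+t. ennreal (\<bar>F t - F (t - v n)\<bar> powr p) \<partial>lborel)"
      by (rule nn_integral_liminf) measurable
    also have "\<dots> \<le> liminf (\<lambda>n. ennreal c)"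
      by (rule Liminf_mono) (use v in auto)
    also have "\<dots> = ennreal c" by (simp add: Liminf_const)
    finally show ?thesis .
  qed
  ultimately show "l \<in> {v \<in> {0..1}. (\<integral>\<^sup>+t. ennreal (\<bar>F t - F (t - v)\<bar> powr p) \<partial>lborel) \<le> ennreal c}"
    by simp
qed

text \<open>Otherwise the complements of the E n would be relatively open and dense in [0, 1] with
  empty intersection, against Baire's theorem.\<close>

lemma closed_cover_contains_interval:
  fixes E :: "nat \<Rightarrow> real set"
  assumes cl: "\<And>n. closed (E n)" and cov: "{0..1} \<subseteq> (\<Union>n. E n)"
  obtains n a b where "0 \<le> a" "a < b" "b \<le> 1" "{a..b} \<subseteq> E n"
proof -
  have "\<exists>n. \<not> {0..1} \<subseteq> closure ({0..1} - E n)"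
  proof (rule ccontr)
    assume neg: "\<not> ?thesis"
    have "{0..1} \<subseteq> closure (\<Inter> (range (\<lambda>n. {0..1} - E n)))"
    proof (rule Baire)
      fix T assume "T \<in> range (\<lambda>n. {0..1} - E n)"
      then obtain n where T: "T = {0..1} - E n" by auto
      have "openin (top_of_set {0..1}) ({0..1} \<inter> (- E n))"
        using cl by (intro openin_open_Int) (simp add: open_Compl)
      moreover have "{0..1} \<inter> (- E n) = T" using T by auto
      ultimately show "openin (top_of_set {0..1}) T \<and> {0..1} \<subseteq> closure T"
        using neg T by auto
    qed auto
    moreover have "\<Inter> (range (\<lambda>n. {0..1} - E n)) = {}" using cov by auto
    ultimately have "{0..1::real} \<subseteq> {}" by (simp only: closure_empty)
    then show False by simp
  qed
  then obtain n where "\<not> {0..1} \<subseteq> closure ({0..1} - E n)" by blast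
  then obtain z where z: "z \<in> {0..1}" "z \<notin> closure ({0..1} - E n)" by blast
  then obtain e where e: "e > 0" "\<And>y. y \<in> {0..1} \<Longrightarrow> dist y z < e \<Longrightarrow> y \<in> E n"
    unfolding closure_approachable by blast
  \<comment> \<open>Since d \<le> 1/2, the interval from z towards the middle of [0, 1] does not
    leave [0, 1].\<close>
  define d where "d = min (e / 2) (1 / 2)"
  have d: "d > 0" "d < e" "d \<le> 1/2" using e(1) by (auto simp: d_def min_def)
  show ?thesis
  proof (cases "z \<le> 1/2")
    case True
    have "{z..z+d} \<subseteq> E n" using e(2) d z True by (auto simp: dist_real_def)
    then show ?thesis using that[of z "z + d" n] d z True by auto
  next
    case False
    have "{z-d..z} \<subseteq> E n" using e(2) d z False by (auto simp: dist_real_def)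
    then show ?thesis using that[of "z - d" z n] d z False by auto
  qed
qed

text \<open>The sets \<open>{v \<in> {0..1}. S v \<le> n}\<close> are closed by Fatou's lemma, so by Baire's theorem one of
  them contains an interval; quasi-subadditivity of \<open>S\<close> then transports the bound to \<open>{0..1}\<close>.\<close>

lemma shift_difference_uniform_bound:
  fixes F :: "real \<Rightarrow> real" and p :: real
  defines "S \<equiv> \<lambda>v. \<integral>\<^sup>+t. ennreal (\<bar>F t - F (t - v)\<bar> powr p) \<partial>lborel"
  assumes p: "p \<ge> 1" and F: "continuous_on UNIV F"
    and fin: "\<And>v. v \<in> {0<..1} \<Longrightarrow> S v < \<infinity>"
  obtains K where "K < \<infinity>" "\<And>v. v \<in> {0..1} \<Longrightarrow> S v \<le> K"
proof -
  have [measurable]: "F \<in> borel_measurable borel" using F by (rule borel_measurable_continuous_onI)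
  have p0: "p \<ge> 0" using p by simp
  have sub: "S (u + v) \<le> ennreal (2 powr p) * (S u + S v)" "S u \<le> ennreal (2 powr p) * (S (a + u) + S a)"
    for u v a
    unfolding S_def by (rule nn_integral_shift_difference_le[OF p0 \<open>F \<in> borel_measurable borel\<close>])+
  define E where "E n = {v \<in> {0..1}. S v \<le> ennreal (real n)}" for n
  have "closed (E n)" for n
    unfolding E_def S_def by (rule closed_shift_difference_sublevel[OF p F])
  moreover have "{0..1} \<subseteq> (\<Union>n. E n)"
  proof
    fix v :: real assume v: "v \<in> {0..1}"
    have "S v < \<infinity>"
    \<comment> \<open>The shift 0 is outside the hypothesis, but its difference vanishes
      identically.\<close>
    proof (cases "v = 0")
      case True
      then show ?thesis by (simp add: S_def)
    qed (use v fin[of v] in auto)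
    then obtain c where c: "S v = ennreal c" "c \<ge> 0" by (cases "S v") auto
    obtain n where "c \<le> real n" using real_arch_simple by blast
    then show "v \<in> (\<Union>n. E n)" using c v by (auto simp: E_def intro!: exI[of _ n] ennreal_leI)
  qed
  ultimately obtain n a b where ab: "0 \<le> a" "a < b" "b \<le> 1" "{a..b} \<subseteq> E n"
    using closed_cover_contains_interval by metis
  define C where "C = ennreal (2 powr p)"
  define L where "L = C * (ennreal (real n) + ennreal (real n))"
  have L: "L < \<infinity>" by (simp add: L_def C_def ennreal_mult_less_top)
  \<comment> \<open>A small shift h is the difference of a + h and a, both of which lie in E
    n.\<close>
  have small: "S h \<le> L" if h: "h \<in> {0..b-a}" for h
  proof -
    have "a \<in> E n" "a + h \<in> E n" using ab h by auto
    then have "S (a + h) + S a \<le> ennreal (real n) + ennreal (real n)"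
      by (intro add_mono) (auto simp: E_def)
    then have "ennreal (2 powr p) * (S (a + h) + S a) \<le> L"
      unfolding L_def C_def by (intro mult_left_mono) auto
    with sub(2)[of h a] show ?thesis by (rule order_trans)
  qed
  \<comment> \<open>Each addition of h costs a factor C, so the bound depends on m but not on
    h.\<close>
  have "\<exists>K<\<infinity>. \<forall>h\<in>{0..b-a}. S (real m * h) \<le> K" for m
  proof (induction m)
    case 0
    then show ?case by (intro exI[of _ 0]) (simp add: S_def)
  next
    case (Suc m)
    then obtain K where K: "K < \<infinity>" "\<And>h. h \<in> {0..b-a} \<Longrightarrow> S (real m * h) \<le> K" by blast
    have "S (real (Suc m) * h) \<le> C * (K + L)" if h: "h \<in> {0..b-a}" for h
    proof -
      have "S (real m * h + h) \<le> C * (S (real m * h) + S h)" unfolding C_def by (rule sub(1))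
      also have "\<dots> \<le> C * (K + L)" by (intro mult_left_mono add_mono K small h) auto
      finally show ?thesis by (simp add: algebra_simps)
    qed
    moreover have "C * (K + L) < \<infinity>" using K(1) L by (simp add: C_def ennreal_mult_less_top)
    ultimately show ?case by blast
  qed
  \<comment> \<open>Each v in [0, 1] is then m times the shift v / m, which is less than b -
    a.\<close>
  moreover obtain m where m: "1 / (b - a) < real m" using reals_Archimedean2 by blast
  ultimately obtain K where K: "K < \<infinity>" "\<And>h. h \<in> {0..b-a} \<Longrightarrow> S (real m * h) \<le> K" by blast
  have "0 < 1 / (b - a)" using ab by simp
  then have m0: "real m > 0" using m by linarith
  have "S v \<le> K" if v: "v \<in> {0..1}" for v
  proof -
    have "1 < real m * (b - a)" using m ab by (simp add: field_simps)
    then have "v / real m \<in> {0..b-a}" using v m0 by (auto simp: field_simps)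
    then show ?thesis using K(2)[of "v / real m"] m0 by simp
  qed
  then show ?thesis using that K(1) by blast
qed

text \<open>Because [0, 1] has length one, F t can be moved under the averaging integral, leaving
  the mean of the differences F t - F (t - v). Their common bound K is the input for
  \<open>Lp_line_averaged\<close>.\<close>

lemma Lp_line_shift_difference_average:
  fixes F :: "real \<Rightarrow> real" and p :: real
  assumes p: "p \<ge> 1" and F: "continuous_on UNIV F"
    and fin: "\<And>v. v \<in> {0<..1} \<Longrightarrow> Lp_line p (\<lambda>t. F t - F (t - v))"
  shows "Lp_line p (\<lambda>t. F t - wconv lborel (indicator {0..1}) F t)"
proof -
  have [measurable]: "F \<in> borel_measurable borel" using F by (rule borel_measurable_continuous_onI)
  obtain K where K: "K < \<infinity>"
      "\<And>v. v \<in> {0..1} \<Longrightarrow> (\<integral>\<^sup>+t. ennreal (\<bar>F t - F (t - v)\<bar> powr p) \<partial>lborel) \<le> K"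
    by (rule shift_difference_uniform_bound[OF p F]) (use fin in \<open>auto simp: Lp_line_def\<close>)
  let ?\<mu> = "density lborel (indicator {0..1::real})"
  show ?thesis
  proof (rule Lp_line_averaged[where k = "\<lambda>t s. F t - F (t - s)" and \<mu> = ?\<mu>, OF p])
    show "finite_measure ?\<mu>"
      by (intro finite_measureI) (simp add: emeasure_density)
    have s: "sets (borel \<Otimes>\<^sub>M ?\<mu>) = sets (borel \<Otimes>\<^sub>M borel)" by (intro sets_pair_measure_cong) auto
    show "(\<lambda>(t, s). F t - F (t - s)) \<in> borel_measurable (borel \<Otimes>\<^sub>M ?\<mu>)"
      unfolding measurable_cong_sets[OF s refl] by measurable
    show "(\<lambda>t. F t - wconv lborel (indicator {0..1}) F t) \<in> borel_measurable borel"
      unfolding wconv_def by measurable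
    show "AE s in ?\<mu>. (\<integral>\<^sup>+t. ennreal (\<bar>F t - F (t - s)\<bar> powr p) \<partial>lborel) \<le> K"
      by (subst AE_density) (auto simp: indicator_def intro!: AE_I2 K(2))
    fix t
    have int: "integrable lborel (\<lambda>s. indicator {0..1} s * F (t - s))"
    proof -
      have "continuous_on {0..1} (\<lambda>s. F (t - s))"
        by (intro continuous_on_compose2[OF F] continuous_intros) auto
      from borel_integrable_atLeastAtMost'[OF this]
      show ?thesis by (simp add: set_integrable_def)
    qed
    have int1: "integrable lborel (\<lambda>s::real. indicator {0..1} s * F t)"
      by (intro integrable_mult_left integrable_real_indicator)
        (auto simp: emeasure_lborel_Icc_eq)
    have "F t - wconv lborel (indicator {0..1}) F t = (\<integral>s. indicator {0..1} s * (F t - F (t - s)) \<partial>lborel)"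
      unfolding wconv_def right_diff_distrib Bochner_Integration.integral_diff[OF int1 int] by simp
    then have "ennreal \<bar>F t - wconv lborel (indicator {0..1}) F t\<bar>
        \<le> (\<integral>\<^sup>+s. ennreal \<bar>indicator {0..1} s * (F t - F (t - s))\<bar> \<partial>lborel)"
      by (simp only: ennreal_abs_integral_le)
    also have "\<dots> = (\<integral>\<^sup>+s. ennreal \<bar>F t - F (t - s)\<bar> \<partial>?\<mu>)"
      by (subst nn_integral_density) (auto intro!: nn_integral_cong simp: indicator_def)
    finally show "ennreal \<bar>F t - wconv lborel (indicator {0..1}) F t\<bar> \<le> \<dots>" .
  qed fact
qed

section \<open>Solutions of the integrodifferential equation\<close>

text \<open>This is the convolution \<nu> * A; the splitting reduces its properties to convolutions
  with two finite positive measures.\<close>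

definition signed_wconv :: "(real set \<Rightarrow> real) \<Rightarrow> (real \<Rightarrow> real) \<Rightarrow> real \<Rightarrow> real" where
  "signed_wconv \<nu> A t =
     wconv (borel_of_halfline (positive_variation borel_halfline \<nu>)) (indicator {0..}) A t
     - wconv (borel_of_halfline (negative_variation borel_halfline \<nu>)) (indicator {0..}) A t"

lemma signed_set_integral_eq_signed_wconv:
  assumes "bounded_causal (\<lambda>t. indicator {0..} t * x t)"
  shows "signed_set_integral borel_halfline \<nu> {0..t} (\<lambda>s. x (t - s))
     = signed_wconv \<nu> (\<lambda>t. indicator {0..} t * x t) t"
  using bounded_causal_measurable[OF assms]
  by (simp add: signed_set_integral_def signed_wconv_def wconv_def set_integral_halfline_measure)

context
  fixes \<nu> :: "real set \<Rightarrow> real"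
  assumes \<nu>: "finite_signed_measure borel_halfline \<nu>"
begin

abbreviation (input) "pos \<equiv> borel_of_halfline (positive_variation borel_halfline \<nu>)"
abbreviation (input) "neg \<equiv> borel_of_halfline (negative_variation borel_halfline \<nu>)"

lemma finite_measure_pos_neg: "finite_measure pos" "finite_measure neg"
  by (intro finite_measure_borel_of_halfline finite_measure_positive_variation
      finite_measure_negative_variation \<nu>; simp)+

lemma sets_pos_neg: "sets pos = sets borel" "sets neg = sets borel"
  by simp_all

lemma causal_weight_pos_neg:
  "causal_weight pos (indicator {0..})" "causal_weight neg (indicator {0..})"
  by (intro causal_weight_finite_measure finite_measure_pos_neg sets_pos_neg)+

lemma bounded_causal_signed_wconv:
  "bounded_causal A \<Longrightarrow> bounded_causal (signed_wconv \<nu> A)"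
  unfolding signed_wconv_def
  by (intro bounded_causal_diff bounded_causal_wconv causal_weight_pos_neg)

lemma signed_wconv_commute:
  assumes w: "causal_weight M w" and A: "bounded_causal A"
  shows "wconv M w (signed_wconv \<nu> A) = signed_wconv \<nu> (wconv M w A)"
  unfolding signed_wconv_def
  by (simp add: wconv_diff_right[OF w] bounded_causal_wconv causal_weight_pos_neg A
      wconv_wconv_commute[OF w causal_weight_pos_neg(1) A]
      wconv_wconv_commute[OF w causal_weight_pos_neg(2) A])

lemma Lp_line_signed_wconv:
  assumes p: "p \<ge> 1" and g: "Lp_line p g"
  shows "Lp_line p (signed_wconv \<nu> g)"
  unfolding signed_wconv_def
  by (intro Lp_line_diff Lp_line_wconv_finite finite_measure_pos_neg sets_pos_neg g) (use p in auto)

text \<open>The integral form of the equation, valid on the whole line because both sides vanish at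
  negative times. All later arguments about x and r start from it.\<close>

lemma solution_eq_integral:
  assumes x: "is_solution \<nu> f \<xi> x" and f0: "causal_weight lborel f0"
    and ae: "AE t in lebesgue. 0 \<le> t \<longrightarrow> f t = f0 t"
  defines "X \<equiv> \<lambda>t. indicator {0..} t * x t"
  shows "bounded_causal X"
    and "X = (\<lambda>t. \<xi> * indicator {0..} t + wconv lborel (\<lambda>t. signed_wconv \<nu> X t + f0 t) (indicator {0..}) t)"
proof -
  have ac: "locally_abs_continuous_halfline x" and x0: "x 0 = \<xi>" using x by (auto simp: is_solution_def)
  show X: "bounded_causal X" unfolding X_def using bounded_causal_locally_abs_continuous[OF ac] .
  have w: "causal_weight lborel (\<lambda>t. signed_wconv \<nu> X t + f0 t)"
    by (intro causal_weight_add f0 causal_weight_bounded_causal bounded_causal_signed_wconv X)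
  have D: "AE t in lebesgue. t > 0 \<longrightarrow> (x has_real_derivative (signed_wconv \<nu> X t + f t)) (at t)"
    using x signed_set_integral_eq_signed_wconv[OF X[unfolded X_def]] by (simp add: is_solution_def X_def)
  have E: "AE t in lebesgue. 0 \<le> t \<longrightarrow> signed_wconv \<nu> X t + f t = signed_wconv \<nu> X t + f0 t"
    using ae by eventually_elim auto
  have *: "x t = x 0 + wconv lborel (\<lambda>t. signed_wconv \<nu> X t + f0 t) (indicator {0..}) t" if "t \<ge> 0" for t
    by (rule locally_abs_continuous_eq_integral[OF ac D w E that])
  have "bounded_causal (wconv lborel (\<lambda>t. signed_wconv \<nu> X t + f0 t) (indicator {0..}))"
    by (intro bounded_causal_wconv w bounded_causal_indicator)
  then show "X = (\<lambda>t. \<xi> * indicator {0..} t + wconv lborel (\<lambda>t. signed_wconv \<nu> X t + f0 t) (indicator {0..}) t)"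
    using * by (auto simp: X_def fun_eq_iff indicator_def x0 bounded_causal_zero)
qed

lemma causal_weight_0: "causal_weight lborel (\<lambda>_. 0)"
  by (auto simp: causal_weight_def lborel.sigma_finite_measure_axioms)

lemma resolvent_eq_integral:
  assumes r: "is_differential_resolvent \<nu> r"
  defines "R \<equiv> \<lambda>t. indicator {0..} t * r t"
  shows "bounded_causal R" and "R = (\<lambda>t. indicator {0..} t + wconv lborel (signed_wconv \<nu> R) (indicator {0..}) t)"
proof -
  have r': "is_solution \<nu> (\<lambda>_. 0) 1 r"
    using r by (simp add: is_solution_def is_differential_resolvent_def)
  note * = solution_eq_integral[OF r' causal_weight_0 AE_I2, folded R_def]
  show "bounded_causal R" by (rule *(1)) simp
  have "R = (\<lambda>t. 1 * indicator {0..} t + wconv lborel (\<lambda>t. signed_wconv \<nu> R t + 0) (indicator {0..}) t)"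
    by (rule *(2)) simp
  then show "R = (\<lambda>t. indicator {0..} t + wconv lborel (signed_wconv \<nu> R) (indicator {0..}) t)"
    by simp
qed

text \<open>Integration by parts, \<open>r * w = 1 * w + r' * (1 * w)\<close> with \<open>\<rho> = r'\<close>.\<close>

lemma wconv_resolvent:
  assumes R: "bounded_causal R" and \<rho>: "causal_weight lborel \<rho>"
    and eq: "R = (\<lambda>t. indicator {0..} t + wconv lborel \<rho> (indicator {0..}) t)"
    and w: "causal_weight lborel w"
  shows "wconv lborel w R =
     (\<lambda>t. wconv lborel w (indicator {0..}) t + wconv lborel \<rho> (wconv lborel w (indicator {0..})) t)"
proof -
  have "wconv lborel w R = wconv lborel w (\<lambda>t. indicator {0..} t + wconv lborel \<rho> (indicator {0..}) t)"
    using eq by (rule arg_cong)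
  also have "\<dots> = (\<lambda>t. wconv lborel w (indicator {0..}) t + wconv lborel w (wconv lborel \<rho> (indicator {0..})) t)"
    by (intro wconv_add_right w bounded_causal_indicator bounded_causal_wconv \<rho>)
  also have "wconv lborel w (wconv lborel \<rho> (indicator {0..})) = wconv lborel \<rho> (wconv lborel w (indicator {0..}))"
    by (intro wconv_wconv_commute w \<rho> bounded_causal_indicator)
  finally show ?thesis .
qed

text \<open>With \<phi> = x', the convolution \<phi> * R is computed twice. Integration by parts
  gives X + \<rho> * X - \<xi> R. Splitting \<phi> = \<nu> * X + f gives \<rho> * X + f * R, because
  \<nu> can be moved from X to R. The common term \<rho> * X cancels.\<close>

lemma variation_of_constants:
  assumes x: "is_solution \<nu> f \<xi> x" and f0: "causal_weight lborel f0"
    and ae: "AE t in lebesgue. 0 \<le> t \<longrightarrow> f t = f0 t"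
    and r: "is_differential_resolvent \<nu> r"
  defines "X \<equiv> \<lambda>t. indicator {0..} t * x t" and "R \<equiv> \<lambda>t. indicator {0..} t * r t"
  shows "X = (\<lambda>t. \<xi> * R t + wconv lborel f0 R t)"
proof
  fix t
  let ?H = "indicator {0..} :: real \<Rightarrow> real"
  note X = solution_eq_integral[OF x f0 ae, folded X_def]
  note R = resolvent_eq_integral[OF r, folded R_def]
  define \<rho> where "\<rho> = signed_wconv \<nu> R"
  define \<phi> where "\<phi> t = signed_wconv \<nu> X t + f0 t" for t
  have \<rho>: "bounded_causal \<rho>" unfolding \<rho>_def by (intro bounded_causal_signed_wconv R)
  note w\<rho> = causal_weight_bounded_causal[OF \<rho>]
  have wV: "causal_weight lborel (signed_wconv \<nu> X)"
    by (intro causal_weight_bounded_causal bounded_causal_signed_wconv X)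
  have w\<phi>: "causal_weight lborel \<phi>" unfolding \<phi>_def by (intro causal_weight_add f0 wV)
  have H: "bounded_causal ?H" by (rule bounded_causal_indicator)
  have \<phi>H: "wconv lborel \<phi> ?H = (\<lambda>t. X t - \<xi> * ?H t)"
    using X(2) by (simp add: \<phi>_def[abs_def] fun_eq_iff)
  have \<rho>H: "wconv lborel \<rho> ?H t = R t - ?H t"
    using fun_cong[OF R(2), of t] by (simp add: \<rho>_def)
  have "wconv lborel \<phi> R t = wconv lborel \<phi> ?H t + wconv lborel \<rho> (wconv lborel \<phi> ?H) t"
    using wconv_resolvent[OF R(1) w\<rho> R(2)[folded \<rho>_def] w\<phi>] by (simp add: fun_eq_iff)
  also have "\<dots> = X t - \<xi> * ?H t + (wconv lborel \<rho> X t - \<xi> * wconv lborel \<rho> ?H t)"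
    unfolding \<phi>H
    by (simp add: wconv_diff_right[OF w\<rho> X(1) bounded_causal_cmult[OF H]] wconv_cmult_right)
  finally have 1: "wconv lborel \<phi> R t = X t + wconv lborel \<rho> X t - \<xi> * R t"
    by (simp add: \<rho>H algebra_simps)
  have "wconv lborel \<phi> R t = wconv lborel (signed_wconv \<nu> X) R t + wconv lborel f0 R t"
    unfolding \<phi>_def by (simp add: wconv_add_left[OF wV f0 R(1)])
  also have "wconv lborel (signed_wconv \<nu> X) R = wconv lborel R (signed_wconv \<nu> X)"
    by (rule wconv_lborel_commute)
  also have "\<dots> = signed_wconv \<nu> (wconv lborel R X)"
    by (intro signed_wconv_commute causal_weight_bounded_causal R X)
  also have "wconv lborel R X = wconv lborel X R" by (rule wconv_lborel_commute)
  also have "signed_wconv \<nu> (wconv lborel X R) = wconv lborel X \<rho>"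
    unfolding \<rho>_def by (intro signed_wconv_commute[symmetric] causal_weight_bounded_causal R X)
  also have "\<dots> = wconv lborel \<rho> X" by (rule wconv_lborel_commute)
  finally show "X t = \<xi> * R t + wconv lborel f0 R t" using 1 by simp
qed

text \<open>The derivative \<nu> * r is integrable because r is, so r is bounded by 1 plus the L^1
  norm of its derivative; a bounded integrable function lies in L^p for all p \<ge> 1.\<close>

lemma Lp_line_resolvent:
  assumes r: "is_differential_resolvent \<nu> r" and r1: "Lp_halfline 1 r" and p: "p \<ge> 1"
  defines "R \<equiv> \<lambda>t. indicator {0..} t * r t"
  shows "Lp_line 1 R" "Lp_line p R"
proof -
  note R = resolvent_eq_integral[OF r, folded R_def]
  show R1: "Lp_line 1 R"
    using r1 bounded_causal_measurable[OF R(1)] unfolding R_def by (simp add: Lp_halfline_iff_Lp_line)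
  define \<rho> where "\<rho> = signed_wconv \<nu> R"
  have "Lp_line 1 \<rho>" unfolding \<rho>_def by (intro Lp_line_signed_wconv R1) simp
  then have \<rho>1: "integrable lborel \<rho>" by (simp add: Lp_line_1_iff_integrable)
  have "\<bar>R t\<bar> \<le> 1 + (\<integral>u. \<bar>\<rho> u\<bar> \<partial>lborel)" for t
  proof -
    have "\<bar>wconv lborel \<rho> (indicator {0..}) t\<bar> \<le> (\<integral>u. \<bar>\<rho> u * indicator {0..} (t - u)\<bar> \<partial>lborel)"
      unfolding wconv_def by (rule integral_abs_bound)
    also have "\<dots> \<le> (\<integral>u. \<bar>\<rho> u\<bar> \<partial>lborel)"
      using \<rho>1 by (intro integral_mono') (auto simp: indicator_def)
    finally have "\<bar>wconv lborel \<rho> (indicator {0..}) t\<bar> \<le> (\<integral>u. \<bar>\<rho> u\<bar> \<partial>lborel)" .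
    moreover have "R t = indicator {0..} t + wconv lborel \<rho> (indicator {0..}) t"
      using fun_cong[OF R(2), of t] by (simp add: \<rho>_def)
    moreover have "\<bar>indicator {0..} t :: real\<bar> \<le> 1" by (simp add: indicator_def)
    ultimately show ?thesis by linarith
  qed
  then show "Lp_line p R" by (rule Lp_line_of_L1_bounded[OF p R1])
qed

lemma Lp_line_wconv_resolvent:
  assumes r: "is_differential_resolvent \<nu> r" and r1: "Lp_halfline 1 r" and p: "p \<ge> 1"
    and f0: "causal_weight lborel f0"
  defines "R \<equiv> \<lambda>t. indicator {0..} t * r t" and "F \<equiv> wconv lborel f0 (indicator {0..})"
  assumes fin: "\<And>v. v \<in> {0<..1} \<Longrightarrow> Lp_line p (\<lambda>t. F t - F (t - v))"
  shows "Lp_line p (wconv lborel f0 R)"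
proof -
  let ?H = "indicator {0..} :: real \<Rightarrow> real" and ?I = "indicator {0..1} :: real \<Rightarrow> real"
  note R = resolvent_eq_integral[OF r, folded R_def]
  note RL = Lp_line_resolvent[OF r r1 p, folded R_def]
  define \<rho> where "\<rho> = signed_wconv \<nu> R"
  have \<rho>: "bounded_causal \<rho>" unfolding \<rho>_def by (intro bounded_causal_signed_wconv R)
  note w\<rho> = causal_weight_bounded_causal[OF \<rho>]
  note parts = wconv_resolvent[OF R(1) w\<rho> R(2)[folded \<rho>_def]]
  have I: "bounded_causal ?I"
    by (rule bounded_causalI) (auto intro!: exI[of _ 1] simp: indicator_def)
  note H = bounded_causal_indicator
  have F: "bounded_causal F" unfolding F_def by (intro bounded_causal_wconv f0 H)
  \<comment> \<open>Convolution with this indicator replaces f by its integral over [t - 1, t], the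
    hypothesis at v = 1.\<close>
  define f1 where "f1 = wconv lborel f0 ?I"
  have f1: "bounded_causal f1" unfolding f1_def by (intro bounded_causal_wconv f0 I)
  note wf1 = causal_weight_bounded_causal[OF f1]
  have f1_eq: "f1 = (\<lambda>t. F t - F (t - 1))"
  proof
    fix t
    have "f1 t = (\<integral>u. indicator {t - 1..t} u * f0 u \<partial>lborel)"
      unfolding f1_def wconv_def by (rule Bochner_Integration.integral_cong) (auto simp: indicator_def)
    then show "f1 t = F t - F (t - 1)"
      unfolding F_def by (subst wconv_indicator_diff[OF f0]) auto
  qed
  define F1 where "F1 = wconv lborel f1 ?H"
  have F1: "bounded_causal F1" unfolding F1_def by (intro bounded_causal_wconv wf1 H)
  \<comment> \<open>The primitive of the smoothed f is the smoothed primitive, so F2 is F minus its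
    average over the shifts in [0, 1].\<close>
  have "F1 = wconv lborel ?H (wconv lborel f0 ?I)"
    unfolding F1_def f1_def by (rule wconv_lborel_commute)
  also have "\<dots> = wconv lborel f0 (wconv lborel ?H ?I)"
    by (intro wconv_wconv_commute causal_weight_bounded_causal f0 I H)
  also have "\<dots> = wconv lborel f0 (wconv lborel ?I ?H)"
    by (simp only: wconv_lborel_commute[of ?H])
  also have "\<dots> = wconv lborel ?I F"
    unfolding F_def by (intro wconv_wconv_commute causal_weight_bounded_causal f0 I H)
  finally have F1_eq: "F1 = wconv lborel ?I F" .
  define F2 where "F2 t = F t - F1 t" for t
  have F2: "Lp_line p F2"
    using Lp_line_shift_difference_average[OF p _ fin] continuous_on_wconv_indicator[OF f0]
    by (simp add: F2_def[abs_def] F1_eq F_def)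
  \<comment> \<open>Parts is applied to f and to f1 and the results are subtracted: F and F1 need
    not lie in L^p separately, but their difference F2 does, and R * f1 is left for Young's
    inequality.\<close>
  have "wconv lborel f0 R t = wconv lborel R f1 t + (F2 t + wconv lborel \<rho> F2 t)" for t
  proof -
    have "wconv lborel f0 R t = F t + wconv lborel \<rho> F t"
      unfolding parts[OF f0] F_def ..
    moreover have "wconv lborel R f1 t = F1 t + wconv lborel \<rho> F1 t"
      unfolding wconv_lborel_commute[of R] parts[OF wf1] F1_def ..
    moreover have "wconv lborel \<rho> F2 t = wconv lborel \<rho> F t - wconv lborel \<rho> F1 t"
      unfolding F2_def by (simp add: wconv_diff_right[OF w\<rho> F F1])
    ultimately show ?thesis by (simp add: F2_def)
  qed
  then have "wconv lborel f0 R = (\<lambda>t. wconv lborel R f1 t + (F2 t + wconv lborel \<rho> F2 t))" by blast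
  moreover have "Lp_line p f1" unfolding f1_eq by (rule fin) simp
  moreover have "Lp_line 1 \<rho>" unfolding \<rho>_def by (intro Lp_line_signed_wconv RL) simp
  ultimately show ?thesis
    using p by (auto intro!: Lp_line_add Lp_line_wconv_lborel F2 RL)
qed

text \<open>The function \<eta> = \<nu> * x is in L^p. Its primitive need not be, but increments of
  the primitive are, and the increments of x are differences of translates.\<close>

lemma Lp_line_primitive_shift_difference:
  assumes x: "is_solution \<nu> f 0 x" and f0: "causal_weight lborel f0"
    and ae: "AE t in lebesgue. 0 \<le> t \<longrightarrow> f t = f0 t"
    and p: "p \<ge> 1" and X_Lp: "Lp_line p (\<lambda>t. indicator {0..} t * x t)" and \<theta>: "\<theta> \<ge> 0"
  defines "F \<equiv> wconv lborel f0 (indicator {0..})"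
  shows "Lp_line p (\<lambda>t. F (t + \<theta>) - F t)"
proof -
  define X where "X = (\<lambda>t. indicator {0..} t * x t)"
  note X = solution_eq_integral[OF x f0 ae, folded X_def]
  define \<eta> where "\<eta> = signed_wconv \<nu> X"
  have \<eta>: "Lp_line p \<eta>" unfolding \<eta>_def X_def by (intro Lp_line_signed_wconv p X_Lp)
  have w\<eta>: "causal_weight lborel \<eta>"
    unfolding \<eta>_def by (intro causal_weight_bounded_causal bounded_causal_signed_wconv X)
  have X_eq: "X t = wconv lborel \<eta> (indicator {0..}) t + F t" for t
  proof -
    have "X t = wconv lborel (\<lambda>t. \<eta> t + f0 t) (indicator {0..}) t"
      using fun_cong[OF X(2), of t] by (simp add: \<eta>_def)
    then show ?thesis
      by (simp add: wconv_add_left[OF w\<eta> f0 bounded_causal_indicator] F_def)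
  qed
  \<comment> \<open>The window [t, t + \<theta>] looks forward, hence the kernel on negative
    arguments: it evaluates \<eta> at t - s with -\<theta> \<le> s \<le> 0.\<close>
  have E: "wconv lborel \<eta> (indicator {0..}) (t + \<theta>) - wconv lborel \<eta> (indicator {0..}) t
      = wconv lborel (indicator {-\<theta>..0}) \<eta> t" for t
    unfolding wconv_lborel_commute[of "indicator {-\<theta>..0}"]
    using \<theta> by (subst wconv_indicator_diff[OF w\<eta>])
      (auto simp: wconv_def indicator_def intro!: Bochner_Integration.integral_cong)
  have "Lp_line p (\<lambda>t. (X (t + \<theta>) - X t) - wconv lborel (indicator {-\<theta>..0}) \<eta> t)"
  proof (intro Lp_line_diff Lp_line_translate Lp_line_wconv_lborel \<eta> p)
    show "Lp_line 1 (indicator {-\<theta>..0})"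
      by (rule Lp_line_bounded_support[of _ _ 1 "-\<theta>" 0]) (auto simp: indicator_def)
  qed (use p X_Lp in \<open>auto simp: X_def\<close>)
  moreover have "(X (t + \<theta>) - X t) - wconv lborel (indicator {-\<theta>..0}) \<eta> t = F (t + \<theta>) - F t" for t
    using E[of t] X_eq[of t] X_eq[of "t + \<theta>"] by simp
  ultimately show ?thesis by simp
qed

end

text \<open>At negative times the difference reduces to F (t + \<theta>), which lives on [-\<theta>,
  0) and is bounded there, so it lies in every L^p under consideration.\<close>

lemma Lp_line_halfline_shift_difference_iff:
  assumes F: "bounded_causal F" and p: "p \<ge> 0" and \<theta>: "\<theta> \<ge> 0"
  shows "Lp_line p (\<lambda>t. indicator {0..} t * (F (t + \<theta>) - F t)) \<longleftrightarrow> Lp_line p (\<lambda>t. F (t + \<theta>) - F t)"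
proof
  note [measurable] = bounded_causal_measurable[OF F]
  show "Lp_line p (\<lambda>t. indicator {0..} t * (F (t + \<theta>) - F t))" if "Lp_line p (\<lambda>t. F (t + \<theta>) - F t)"
    by (rule Lp_line_mono[OF p that]) (auto simp: indicator_def)
  assume L: "Lp_line p (\<lambda>t. indicator {0..} t * (F (t + \<theta>) - F t))"
  obtain C where C: "C \<ge> 0" "\<And>t. t \<le> \<theta> \<Longrightarrow> \<bar>F t\<bar> \<le> C" using bounded_causal_bound[OF F] by metis
  have "Lp_line p (\<lambda>t. indicator {-\<theta>..<0} t * F (t + \<theta>))"
    by (rule Lp_line_bounded_support[of _ _ C "-\<theta>" 0]) (use p C in \<open>auto simp: indicator_def\<close>)
  then have "Lp_line p (\<lambda>t. indicator {0..} t * (F (t + \<theta>) - F t) + indicator {-\<theta>..<0} t * F (t + \<theta>))"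
    by (rule Lp_line_add[OF p L])
  moreover have "indicator {0..} t * (F (t + \<theta>) - F t) + indicator {-\<theta>..<0} t * F (t + \<theta>) = F (t + \<theta>) - F t" for t
    using bounded_causal_zero[OF F, of t] bounded_causal_zero[OF F, of "t + \<theta>"]
    by (auto simp: indicator_def)
  ultimately show "Lp_line p (\<lambda>t. F (t + \<theta>) - F t)" by simp
qed

text \<open>Condition (A) looks forward on the half-line, while the Baire argument uses backward
  shifts on the whole line; a translation by \<theta> converts one into the other.\<close>

lemma Lp_halfline_set_integral_iff:
  assumes f: "L1_loc_halfline f" and f0: "causal_weight lborel f0"
    and ae: "AE t in lebesgue. 0 \<le> t \<longrightarrow> f t = f0 t"
    and p: "p \<ge> 0" and \<theta>: "\<theta> \<ge> 0"
  defines "F \<equiv> wconv lborel f0 (indicator {0..})"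
  shows "Lp_halfline p (\<lambda>t. set_lebesgue_integral lebesgue {t..t+\<theta>} f)
    \<longleftrightarrow> Lp_line p (\<lambda>t. F t - F (t - \<theta>))"
proof -
  have F: "bounded_causal F" unfolding F_def by (intro bounded_causal_wconv f0 bounded_causal_indicator)
  note [measurable] = bounded_causal_measurable[OF F]
  have "Lp_halfline p (\<lambda>t. set_lebesgue_integral lebesgue {t..t+\<theta>} f)
     \<longleftrightarrow> Lp_halfline p (\<lambda>t. F (t + \<theta>) - F t)"
  proof (rule Lp_halfline_cong)
    fix t :: real assume t: "t \<ge> 0"
    have "set_integrable lebesgue {0..t+\<theta>} f" using f t \<theta> by (auto simp: L1_loc_halfline_def)
    then have "set_integrable lebesgue {t..t+\<theta>} f"
      by (rule set_integrable_subset) (use t in auto)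
    then show "set_lebesgue_integral lebesgue {t..t+\<theta>} f = F (t + \<theta>) - F t"
      unfolding F_def
      by (intro set_integral_lebesgue_borel_version[OF f0 ae t]) (use \<theta> in \<open>auto simp: set_integrable_def\<close>)
  qed
  also have "\<dots> \<longleftrightarrow> Lp_line p (\<lambda>t. F (t + \<theta>) - F t)"
    by (subst Lp_halfline_iff_Lp_line) (measurable, rule Lp_line_halfline_shift_difference_iff[OF F p \<theta>])
  also have "\<dots> \<longleftrightarrow> Lp_line p (\<lambda>t. F t - F (t - \<theta>))"
    using Lp_line_translate[of p "\<lambda>t. F (t + \<theta>) - F t" "-\<theta>"]
      Lp_line_translate[of p "\<lambda>t. F t - F (t - \<theta>)" "\<theta>"] by auto
  finally show ?thesis .
qed

theorem theorem1:
  fixes \<nu> :: "real set \<Rightarrow> real"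
    and f r :: "real \<Rightarrow> real"
    and x :: "real \<Rightarrow> real \<Rightarrow> real"
    and p :: real
  assumes "finite_signed_measure borel_halfline \<nu>"
    and "L1_loc_halfline f"
    and "\<And>\<xi>. is_solution \<nu> f \<xi> (\<lambda>t. x t \<xi>)"
    and "is_differential_resolvent \<nu> r"
    and "Lp_halfline 1 r"
    and "p \<ge> 1"
  shows "(\<forall>\<theta>\<in>{0<..1}. Lp_halfline p (\<lambda>t. set_lebesgue_integral lebesgue {t..t+\<theta>} f))
     \<longleftrightarrow> (\<forall>\<xi>. Lp_halfline p (\<lambda>t. x t \<xi>))"
proof -
  note \<nu> = assms(1) and f = assms(2) and x = assms(3) and r = assms(4) and r1 = assms(5) and p = assms(6)
  have p0: "p \<ge> 0" using p by simp
  obtain f0 where f0: "causal_weight lborel f0" and ae: "AE t in lebesgue. 0 \<le> t \<longrightarrow> f t = f0 t"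
    using L1_loc_halfline_borel_version[OF f] by metis
  define F where "F = wconv lborel f0 (indicator {0..})"
  have A: "Lp_halfline p (\<lambda>t. set_lebesgue_integral lebesgue {t..t+\<theta>} f)
      \<longleftrightarrow> Lp_line p (\<lambda>t. F t - F (t - \<theta>))" if "\<theta> \<in> {0<..1}" for \<theta>
    unfolding F_def by (rule Lp_halfline_set_integral_iff[OF f f0 ae p0]) (use that in auto)
  have B: "Lp_halfline p (\<lambda>t. x t \<xi>) \<longleftrightarrow> Lp_line p (\<lambda>t. indicator {0..} t * x t \<xi>)" for \<xi>
    by (intro Lp_halfline_iff_Lp_line bounded_causal_measurable solution_eq_integral(1)[OF \<nu> x f0 ae])
  show ?thesis
  proof
    assume "\<forall>\<theta>\<in>{0<..1}. Lp_halfline p (\<lambda>t. set_lebesgue_integral lebesgue {t..t+\<theta>} f)"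
    then have "Lp_line p (wconv lborel f0 (\<lambda>t. indicator {0..} t * r t))"
      using A by (intro Lp_line_wconv_resolvent[OF \<nu> r r1 p f0]) (auto simp: F_def)
    then show "\<forall>\<xi>. Lp_halfline p (\<lambda>t. x t \<xi>)"
      unfolding B variation_of_constants[OF \<nu> x f0 ae r]
      by (intro allI Lp_line_add Lp_line_cmult Lp_line_resolvent(2)[OF \<nu> r r1 p] p0)
  next
    assume "\<forall>\<xi>. Lp_halfline p (\<lambda>t. x t \<xi>)"
    \<comment> \<open>For \<xi> = 0 the constant term drops out of the integral equation, so F is x
      minus the primitive of \<nu> * x.\<close>
    then have X: "Lp_line p (\<lambda>t. indicator {0..} t * x t 0)" using B by blast
    show "\<forall>\<theta>\<in>{0<..1}. Lp_halfline p (\<lambda>t. set_lebesgue_integral lebesgue {t..t+\<theta>} f)"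
    proof
      fix \<theta> :: real assume \<theta>: "\<theta> \<in> {0<..1}"
      then have "Lp_line p (\<lambda>t. F (t + \<theta>) - F t)"
        unfolding F_def by (intro Lp_line_primitive_shift_difference[OF \<nu> x f0 ae p X]) auto
      from Lp_line_translate[OF this, of "-\<theta>"]
      show "Lp_halfline p (\<lambda>t. set_lebesgue_integral lebesgue {t..t+\<theta>} f)"
        using A[OF \<theta>] by simp
    qed
  qed
qed

end
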